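(* A graph $G$ is a pseudo-cograph if and only if $|V(G)|\le2$ or $G$ can be explained by a labeled level-1 network $(N,t)$ that contains exactly one cycle $C$, where the root of $C$ is the root $\rho_N$ of $N$ and the hybrid-vertex $\eta_C$ of $C$ has exactly one child, which is a leaf.
   Context: Graphs finite, simple, undirected; $G-v$, join, cograph (no induced $P_4$). $G$ is a pseudo-cograph if $|V(G)|\le2$ or there are induced subgraphs $G_1,G_2$ and $v\in V(G)$ with (F1) $V(G)=V(G_1)\cup V(G_2)$, $V(G_1)\cap V(G_2)=\{v\}$, $|V(G_1)|,|V(G_2)|>1$; (F2) $G_1,G_2$ cographs; (F3) $G-v$ is the join or the disjoint union of $G_1-v$ and $G_2-v$. Network on finite $X$: a DAG $N=(V,E)$ with either $V=X=\{x\}$, or (N1) unique root $\rho_N$ of indegree 0, outdegree $\ge2$; (N2) $x\in X$ iff outdegree 0, indegree 1 (leaves); (N3) every other non-root vertex has indegree 1 and outdegree $\ge2$, or indegree 2 (hybrid-vertex) and outdegree $\ge1$. Level-1: every biconnected component of the underlying undirected graph contains at most one hybrid-vertex; then $\mathrm{lca}_N(x,y)$ is unique. Labeled network: $t:V\to\{0,1,\odot\}$, $t(v)=\odot$ iff $v\in X$; it explains $G$ if $G$ is isomorphic to the graph on $X$ with $x\ne y$ adjacent iff $t(\mathrm{lca}_N(x,y))=1$. A cycle is a biconnected component that is not a single vertex or edge; it consists of two internally disjoint directed paths from its root $\rho_C$ to its unique hybrid-vertex $\eta_C$. *)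

theory Defs
  imports Main
begin

section \<open>Simple graphs\<close>

type_synonym 'a graph = "'a set \<times> ('a \<times> 'a) set"

definition is_graph :: "'a graph \<Rightarrow> bool" where
  "is_graph G \<longleftrightarrow> finite (fst G) \<and> snd G \<subseteq> fst G \<times> fst G \<and> sym (snd G) \<and> irrefl (snd G)"

definition induced :: "'a graph \<Rightarrow> 'a set \<Rightarrow> 'a graph" where
  "induced G W = (W, snd G \<inter> (W \<times> W))"

definition del_vertex :: "'a graph \<Rightarrow> 'a \<Rightarrow> 'a graph" where
  "del_vertex G v = induced G (fst G - {v})"

definition disj_union :: "'a graph \<Rightarrow> 'a graph \<Rightarrow> 'a graph" where
  "disj_union G H = (fst G \<union> fst H, snd G \<union> snd H)"

definition gjoin :: "'a graph \<Rightarrow> 'a graph \<Rightarrow> 'a graph" where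
  "gjoin G H = (fst G \<union> fst H,
     snd G \<union> snd H \<union> (fst G \<times> fst H) \<union> (fst H \<times> fst G))"

text \<open>A cograph is a graph without an induced path on four vertices.\<close>
definition cograph :: "'a graph \<Rightarrow> bool" where
  "cograph G \<longleftrightarrow> \<not> (\<exists>a\<in>fst G. \<exists>b\<in>fst G. \<exists>c\<in>fst G. \<exists>d\<in>fst G.
      distinct [a, b, c, d] \<and>
      (a, b) \<in> snd G \<and> (b, c) \<in> snd G \<and> (c, d) \<in> snd G \<and>
      (a, c) \<notin> snd G \<and> (b, d) \<notin> snd G \<and> (a, d) \<notin> snd G)"

definition pseudo_cograph :: "'a graph \<Rightarrow> bool" where
  "pseudo_cograph G \<longleftrightarrow> card (fst G) \<le> 2 \<or>
    (\<exists>V1 V2 v. V1 \<subseteq> fst G \<and> V2 \<subseteq> fst G \<and>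
       fst G = V1 \<union> V2 \<and> V1 \<inter> V2 = {v} \<and> card V1 > 1 \<and> card V2 > 1 \<and>
       cograph (induced G V1) \<and> cograph (induced G V2) \<and>
       (del_vertex G v = gjoin (del_vertex (induced G V1) v) (del_vertex (induced G V2) v) \<or>
        del_vertex G v = disj_union (del_vertex (induced G V1) v) (del_vertex (induced G V2) v)))"

section \<open>Networks\<close>

text \<open>A network is given by a finite vertex set V (vertices are natural numbers),
  an arc set A and the leaf set X.\<close>

definition indeg :: "('v \<times> 'v) set \<Rightarrow> 'v \<Rightarrow> nat" where
  "indeg A v = card {u. (u, v) \<in> A}"

definition outdeg :: "('v \<times> 'v) set \<Rightarrow> 'v \<Rightarrow> nat" where
  "outdeg A v = card {w. (v, w) \<in> A}"

definition net_root :: "'v set \<Rightarrow> ('v \<times> 'v) set \<Rightarrow> 'v" where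
  "net_root V A = (THE r. r \<in> V \<and> indeg A r = 0)"

definition is_network :: "nat set \<Rightarrow> (nat \<times> nat) set \<Rightarrow> nat set \<Rightarrow> bool" where
  "is_network V A X \<longleftrightarrow> finite V \<and> A \<subseteq> V \<times> V \<and> acyclic A \<and> X \<subseteq> V \<and>
    ((V = X \<and> card X = 1 \<and> A = {}) \<or>
     ((\<exists>!r. r \<in> V \<and> indeg A r = 0) \<and> outdeg A (net_root V A) \<ge> 2 \<and>
      (\<forall>x\<in>V. x \<in> X \<longleftrightarrow> outdeg A x = 0 \<and> indeg A x = 1) \<and>
      (\<forall>v\<in>V. v \<noteq> net_root V A \<and> v \<notin> X \<longrightarrow>
          (indeg A v = 1 \<and> outdeg A v \<ge> 2) \<or> (indeg A v = 2 \<and> outdeg A v \<ge> 1))))"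

definition hybrid :: "'v set \<Rightarrow> ('v \<times> 'v) set \<Rightarrow> 'v \<Rightarrow> bool" where
  "hybrid V A v \<longleftrightarrow> v \<in> V \<and> indeg A v = 2"

text \<open>Underlying undirected graph and its biconnected components (blocks).
  Blocks are induced subgraphs, so they are identified with their vertex sets:
  maximal vertex sets inducing a connected subgraph without cut vertex.\<close>

definition und :: "('v \<times> 'v) set \<Rightarrow> ('v \<times> 'v) set" where
  "und A = A \<union> A\<inverse>"

definition connected_on :: "('v \<times> 'v) set \<Rightarrow> 'v set \<Rightarrow> bool" where
  "connected_on A W \<longleftrightarrow> (\<forall>u\<in>W. \<forall>w\<in>W. (u, w) \<in> (und A \<inter> (W \<times> W))\<^sup>*)"

definition biconnected_on :: "('v \<times> 'v) set \<Rightarrow> 'v set \<Rightarrow> bool" where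
  "biconnected_on A W \<longleftrightarrow> W \<noteq> {} \<and> connected_on A W \<and> (\<forall>v\<in>W. connected_on A (W - {v}))"

definition is_block :: "'v set \<Rightarrow> ('v \<times> 'v) set \<Rightarrow> 'v set \<Rightarrow> bool" where
  "is_block V A W \<longleftrightarrow> W \<subseteq> V \<and> biconnected_on A W \<and>
     (\<forall>W'. W \<subseteq> W' \<and> W' \<subseteq> V \<and> biconnected_on A W' \<longrightarrow> W' = W)"

definition level1 :: "'v set \<Rightarrow> ('v \<times> 'v) set \<Rightarrow> bool" where
  "level1 V A \<longleftrightarrow> (\<forall>W. is_block V A W \<longrightarrow> card {h\<in>W. hybrid V A h} \<le> 1)"

text \<open>A cycle is a block that is neither a single vertex nor a single edge.\<close>
definition is_cycle :: "'v set \<Rightarrow> ('v \<times> 'v) set \<Rightarrow> 'v set \<Rightarrow> bool" where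
  "is_cycle V A W \<longleftrightarrow> is_block V A W \<and> card W \<ge> 3"

definition cycle_root :: "('v \<times> 'v) set \<Rightarrow> 'v set \<Rightarrow> 'v" where
  "cycle_root A W = (THE r. r \<in> W \<and> (\<forall>u\<in>W. (u, r) \<notin> A))"

definition cycle_hybrid :: "'v set \<Rightarrow> ('v \<times> 'v) set \<Rightarrow> 'v set \<Rightarrow> 'v" where
  "cycle_hybrid V A W = (THE h. h \<in> W \<and> hybrid V A h)"

section \<open>Lowest common ancestors and labelings\<close>

definition ancestor :: "('v \<times> 'v) set \<Rightarrow> 'v \<Rightarrow> 'v \<Rightarrow> bool" where
  "ancestor A u v \<longleftrightarrow> (u, v) \<in> A\<^sup>*"

definition lca :: "'v set \<Rightarrow> ('v \<times> 'v) set \<Rightarrow> 'v \<Rightarrow> 'v \<Rightarrow> 'v" where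
  "lca V A x y = (THE w. w \<in> V \<and> ancestor A w x \<and> ancestor A w y \<and>
     \<not> (\<exists>w'\<in>V. w' \<noteq> w \<and> ancestor A w w' \<and> ancestor A w' x \<and> ancestor A w' y))"

datatype label = L0 | L1 | LOdot

definition is_labeling :: "'v set \<Rightarrow> 'v set \<Rightarrow> ('v \<Rightarrow> label) \<Rightarrow> bool" where
  "is_labeling V X t \<longleftrightarrow> (\<forall>v\<in>V. t v = LOdot \<longleftrightarrow> v \<in> X)"

text \<open>(N,t) explains G: G is isomorphic to the graph on X in which distinct x,y are
  adjacent iff the lca of x and y is labelled 1.\<close>
definition explains :: "nat set \<Rightarrow> (nat \<times> nat) set \<Rightarrow> nat set \<Rightarrow> (nat \<Rightarrow> label) \<Rightarrow> 'a graph \<Rightarrow> bool" where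
  "explains V A X t G \<longleftrightarrow> (\<exists>f. bij_betw f (fst G) X \<and>
     (\<forall>a\<in>fst G. \<forall>b\<in>fst G. a \<noteq> b \<longrightarrow>
        ((a, b) \<in> snd G \<longleftrightarrow> t (lca V A (f a) (f b)) = L1)))"

end

(* Proof idea. A graph explained by a tree has no induced path on four vertices, since of the three
   lowest common ancestors of any three leaves two coincide and the third lies below them.
   Conversely a P4-free graph or its complement is disconnected, which yields a binary cotree.
   Given a pseudo-cograph, join the cotrees of the two parts by a new root and identify their
   leaves for v in one hybrid-vertex with a single child v. Given a network with its cycle at the
   root, deleting either arc into the hybrid-vertex turns the leaves on the other side of the
   cycle, together with v, into the leaves of a tree, and leaves on different sides have the root
   as lowest common ancestor. *)

theory Submission
  imports Defs
begin

section \<open>Lowest common ancestors\<close>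

text \<open>Cycles are defined as maximal biconnected vertex sets, whereas the argument needs
  directed paths; closing this gap is a large part of the work. Let \<open>p\<close> and
  \<open>q\<close> be the parents of the hybrid-vertex \<open>h\<close>, and \<open>w\<close> their
  lowest common ancestor. The vertices on directed paths from \<open>w\<close> to \<open>h\<close>
  form a biconnected set. No larger set is biconnected: if \<open>h\<close> is the only vertex with
  two parents, the descendants of a vertex off these paths are entered by at most one arc, which is
  a bridge. So the condition on the root of the cycle says that the root of the network is the only
  common ancestor of \<open>p\<close> and \<open>q\<close>. The construction establishes this and
  the converse starts from it.

  Two degenerate situations shape the converse. One parent of \<open>h\<close> may be the root
  itself, so the leaves have to be divided along the side of the other parent. One of the two parts
  may also shrink to the single vertex \<open>v\<close>; then the whole graph has no induced path on
  four vertices and has to be split anew.\<close>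

lemma comparable_ancestors:
  assumes "(u, x) \<in> B\<^sup>*" and "(v, x) \<in> B\<^sup>*"
    and "\<And>a b c. (c, x) \<in> B\<^sup>* \<Longrightarrow> (a, c) \<in> B \<Longrightarrow> (b, c) \<in> B \<Longrightarrow> a = b"
  shows "(u, v) \<in> B\<^sup>* \<or> (v, u) \<in> B\<^sup>*"
  using assms
proof (induction rule: rtrancl_induct)
  case base
  then show ?case by simp
next
  case (step y z)
  show ?case
  proof (cases "v = z")
    case True
    then show ?thesis using step.hyps by (meson rtrancl.rtrancl_into_rtrancl)
  next
    case False
    then obtain y' where "(v, y') \<in> B\<^sup>*" "(y', z) \<in> B"
      using step.prems(1) by (meson rtranclE)
    then have "(v, y) \<in> B\<^sup>*"
      using step.prems(2)[of z y' y] step.hyps(2) by simp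
    moreover have "a = b" if "(c, y) \<in> B\<^sup>*" "(a, c) \<in> B" "(b, c) \<in> B" for a b c
      using step.prems(2)[of c a b] that step.hyps(2) by (meson rtrancl.rtrancl_into_rtrancl)
    ultimately show ?thesis using step.IH by blast
  qed
qed

lemma rtrancl_antisym:
  assumes "acyclic B" "(a, b) \<in> B\<^sup>*" "(b, a) \<in> B\<^sup>*"
  shows "a = b"
  using assms by (meson acyclic_impl_antisym_rtrancl antisymD)

text \<open>A common ancestor with none strictly below it is comparable with all the others, hence
  below them. Parents are required to be unique only above \<open>x\<close>; in a network with one
  hybrid-vertex this holds for each parent of that vertex.\<close>

lemma ex_lowest_common_ancestor:
  assumes fin: "finite B" and acyc: "acyclic B"
    and r: "(r, x) \<in> B\<^sup>*" "(r, y) \<in> B\<^sup>*"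
    and uniq: "\<And>a b c. (c, x) \<in> B\<^sup>* \<Longrightarrow> (a, c) \<in> B \<Longrightarrow> (b, c) \<in> B \<Longrightarrow> a = b"
  obtains m where "(m, x) \<in> B\<^sup>*" "(m, y) \<in> B\<^sup>*"
    "\<And>w. (w, x) \<in> B\<^sup>* \<Longrightarrow> (w, y) \<in> B\<^sup>* \<Longrightarrow> (w, m) \<in> B\<^sup>*"
proof -
  let ?Q = "{w. (w, x) \<in> B\<^sup>* \<and> (w, y) \<in> B\<^sup>*}"
  have "wf ((B\<^sup>+)\<inverse>)"
    using finite_acyclic_wf_converse[OF fin acyc] by (metis trancl_converse wf_trancl)
  moreover have "r \<in> ?Q" using r by simp
  ultimately have "\<exists>m\<in>?Q. \<forall>w. (w, m) \<in> (B\<^sup>+)\<inverse> \<longrightarrow> w \<notin> ?Q"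
    unfolding wf_eq_minimal by meson
  then obtain m where m: "(m, x) \<in> B\<^sup>*" "(m, y) \<in> B\<^sup>*"
    and min: "\<And>w. (m, w) \<in> B\<^sup>+ \<Longrightarrow> w \<notin> ?Q"
    by auto
  have "(w, m) \<in> B\<^sup>*" if "(w, x) \<in> B\<^sup>*" "(w, y) \<in> B\<^sup>*" for w
  proof -
    have "(w, m) \<in> B\<^sup>* \<or> (m, w) \<in> B\<^sup>*"
      using comparable_ancestors[OF that(1) m(1) uniq] .
    moreover have "(m, w) \<notin> B\<^sup>+" using min[of w] that by auto
    ultimately show ?thesis by (metis rtranclD rtrancl.rtrancl_refl)
  qed
  then show ?thesis using that m by metis
qed

text \<open>\<open>lca\<close> describes a minimal common ancestor, of which a DAG may have several.
  One that lies below all the others is the only minimal one, so the definite description can be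
  evaluated.\<close>

lemma lca_eqI:
  assumes "acyclic A" "m \<in> V" "(m, x) \<in> A\<^sup>*" "(m, y) \<in> A\<^sup>*"
    and "\<And>w. w \<in> V \<Longrightarrow> (w, x) \<in> A\<^sup>* \<Longrightarrow> (w, y) \<in> A\<^sup>* \<Longrightarrow> (w, m) \<in> A\<^sup>*"
  shows "lca V A x y = m"
  unfolding lca_def ancestor_def
proof (rule the_equality)
  show "m \<in> V \<and> (m, x) \<in> A\<^sup>* \<and> (m, y) \<in> A\<^sup>* \<and>
    \<not> (\<exists>w'\<in>V. w' \<noteq> m \<and> (m, w') \<in> A\<^sup>* \<and> (w', x) \<in> A\<^sup>* \<and> (w', y) \<in> A\<^sup>*)"
    using assms by (metis rtrancl_antisym)
next
  fix w
  assume "w \<in> V \<and> (w, x) \<in> A\<^sup>* \<and> (w, y) \<in> A\<^sup>* \<and>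
    \<not> (\<exists>w'\<in>V. w' \<noteq> w \<and> (w, w') \<in> A\<^sup>* \<and> (w', x) \<in> A\<^sup>* \<and> (w', y) \<in> A\<^sup>*)"
  then show "w = m" using assms by metis
qed

section \<open>Graphs without induced path on four vertices\<close>

definition p4free :: "'a set \<Rightarrow> ('a \<Rightarrow> 'a \<Rightarrow> bool) \<Rightarrow> bool" where
  "p4free S E \<longleftrightarrow> \<not> (\<exists>a\<in>S. \<exists>b\<in>S. \<exists>c\<in>S. \<exists>d\<in>S. distinct [a, b, c, d] \<and>
      E a b \<and> E b c \<and> E c d \<and> \<not> E a c \<and> \<not> E b d \<and> \<not> E a d)"

lemma p4free_subset: "p4free S E \<Longrightarrow> T \<subseteq> S \<Longrightarrow> p4free T E"
  unfolding p4free_def by (meson subsetD)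

lemma cograph_induced_iff: "cograph (induced G W) \<longleftrightarrow> p4free W (\<lambda>x y. (x, y) \<in> snd G)"
  unfolding cograph_def induced_def p4free_def by auto

text \<open>The argument needs only that the ancestors of each leaf form a chain and that lowest
  common ancestors exist. Stated for an abstract order, it applies to a part of a network that is a
  tree merely as far as the leaves of \<open>S\<close> are concerned.\<close>

lemma p4free_of_lca:
  fixes R :: "('v \<times> 'v) set" and f :: "'a \<Rightarrow> 'v"
  assumes "antisym R" "trans R"
    and chain: "\<And>x u v. x \<in> S \<Longrightarrow> (u, f x) \<in> R \<Longrightarrow> (v, f x) \<in> R \<Longrightarrow> (u, v) \<in> R \<or> (v, u) \<in> R"
    and ex: "\<And>x y. x \<in> S \<Longrightarrow> y \<in> S \<Longrightarrow> x \<noteq> y \<Longrightarrow> \<exists>m. (m, f x) \<in> R \<and> (m, f y) \<in> R \<and>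
      (\<forall>w. (w, f x) \<in> R \<and> (w, f y) \<in> R \<longrightarrow> (w, m) \<in> R) \<and> (E x y \<longleftrightarrow> P m)"
  shows "p4free S E"
proof -
  obtain m where m: "\<And>x y. x \<in> S \<Longrightarrow> y \<in> S \<Longrightarrow> x \<noteq> y \<Longrightarrow>
      (m x y, f x) \<in> R \<and> (m x y, f y) \<in> R \<and>
      (\<forall>w. (w, f x) \<in> R \<and> (w, f y) \<in> R \<longrightarrow> (w, m x y) \<in> R) \<and> (E x y \<longleftrightarrow> P (m x y))"
    using ex by metis
  have m1: "(m x y, f x) \<in> R" and m2: "(m x y, f y) \<in> R" and mE: "E x y \<longleftrightarrow> P (m x y)"
    if "x \<in> S" "y \<in> S" "x \<noteq> y" for x y
    using m[OF that] by blast+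
  have m3: "(w, m x y) \<in> R" if "x \<in> S" "y \<in> S" "x \<noteq> y" "(w, f x) \<in> R" "(w, f y) \<in> R" for w x y
    using m[OF that(1-3)] that(4,5) by blast
  note tr = transD[OF \<open>trans R\<close>] and anti = antisymD[OF \<open>antisym R\<close>]
  have sym: "m x y = m y x" if "x \<in> S" "y \<in> S" "x \<noteq> y" for x y
    using that by (intro anti m3 m1 m2) auto
  have half: "m x y = m y z \<and> (m x y, m x z) \<in> R"
    if S: "x \<in> S" "y \<in> S" "z \<in> S" "x \<noteq> y" "y \<noteq> z" "x \<noteq> z" and le: "(m x y, m y z) \<in> R"
      and lab: "P (m x y) \<noteq> P (m x z)" for x y z
  proof -
    have 1: "(m x y, m x z) \<in> R"
      by (rule m3[OF S(1,3,6) m1[OF S(1,2,4)] tr[OF le m2[OF S(2,3,5)]]])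
    have "(m x z, m y z) \<notin> R"
    proof
      assume "(m x z, m y z) \<in> R"
      then have "(m x z, m x y) \<in> R"
        by (intro m3[OF S(1,2,4)] m1[OF S(1,3,6)] tr[OF _ m1[OF S(2,3,5)]])
      then show False using anti[OF 1] lab by metis
    qed
    then have "(m y z, m x z) \<in> R"
      using chain[OF S(3) m2[OF S(2,3,5)] m2[OF S(1,3,6)]] by blast
    then have "(m y z, m x y) \<in> R"
      by (intro m3[OF S(1,2,4)] m1[OF S(2,3,5)] tr[OF _ m1[OF S(1,3,6)]])
    then show ?thesis using 1 anti[OF le] by blast
  qed
  \<comment> \<open>If the pair \<open>x\<close>, \<open>z\<close> carries the odd label of the
    three, its lca lies below the one that the other two pairs share.\<close>
  have tri: "m x y = m y z \<and> (m x y, m x z) \<in> R"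
    if S: "x \<in> S" "y \<in> S" "z \<in> S" "x \<noteq> y" "y \<noteq> z" "x \<noteq> z"
      and lab: "P (m x y) \<noteq> P (m x z)" "P (m y z) \<noteq> P (m x z)" for x y z
  proof -
    have "(m x y, m y z) \<in> R \<or> (m y z, m x y) \<in> R"
      using chain[OF S(2) m2[OF S(1,2,4)] m1[OF S(2,3,5)]] .
    then show ?thesis
    proof
      assume "(m x y, m y z) \<in> R"
      then show ?thesis using half S lab by blast
    next
      assume "(m y z, m x y) \<in> R"
      then have "(m z y, m y x) \<in> R" using sym S by metis
      then have "m z y = m y x \<and> (m z y, m z x) \<in> R"
        using half[of z y x] S lab sym by metis
      then show ?thesis using sym S by metis
    qed
  qed
  show ?thesis
    unfolding p4free_def
  proof (clarify)
    fix a b c d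
    assume S: "a \<in> S" "b \<in> S" "c \<in> S" "d \<in> S" and dist: "distinct [a, b, c, d]"
      and E: "E a b" "E b c" "E c d" "\<not> E a c" "\<not> E b d" "\<not> E a d"
    \<comment> \<open>The triples \<open>a b c\<close> and \<open>b c d\<close> put
      \<open>m b c\<close>, which is \<open>m a b\<close>, above \<open>m b d\<close>. The triple
      \<open>a d b\<close>, a path in the complement, puts \<open>m b d\<close> above
      \<open>m a b\<close>. So \<open>m b c\<close> and \<open>m b d\<close> agree, although only
      one of the two pairs is adjacent.\<close>
    have "m a b = m b c" using tri[of a b c] S dist E mE by auto
    moreover have "(m b c, m b d) \<in> R" using tri[of b c d] S dist E mE by auto
    moreover have "m a d = m d b \<and> (m a d, m a b) \<in> R"
      using tri[of a d b] S dist E mE sym[of d b] by auto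
    ultimately have "m b c = m b d" using anti[of "m b c" "m b d"] sym[of d b] S dist by auto
    then show False using mE[of b c] mE[of b d] S dist E by auto
  qed
qed

section \<open>Cycles\<close>

lemma und_path:
  assumes "(a, b) \<in> A\<^sup>*" and "\<And>y. (a, y) \<in> A\<^sup>* \<Longrightarrow> (y, b) \<in> A\<^sup>* \<Longrightarrow> y \<in> S"
  shows "(a, b) \<in> (und A \<inter> (S \<times> S))\<^sup>*"
  using assms
proof (induction rule: rtrancl_induct)
  case base
  then show ?case by simp
next
  case (step y z)
  have "(a, y) \<in> (und A \<inter> (S \<times> S))\<^sup>*"
    using step by (meson rtrancl.rtrancl_into_rtrancl)
  moreover have "y \<in> S" "z \<in> S" using step
    by (meson r_into_rtrancl rtrancl.rtrancl_refl rtrancl_trans)+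
  ultimately show ?case using step.hyps(2)
    by (meson IntI SigmaI UnI1 rtrancl.rtrancl_into_rtrancl und_def[THEN equalityD2, THEN subsetD])
qed

lemma und_sym:
  assumes "(a, b) \<in> (und A \<inter> (S \<times> S))\<^sup>*"
  shows "(b, a) \<in> (und A \<inter> (S \<times> S))\<^sup>*"
proof -
  have "sym (und A \<inter> (S \<times> S))" by (auto simp: sym_def und_def)
  then show ?thesis using assms by (meson sym_rtrancl symD)
qed

lemma connected_on_hub:
  assumes "\<And>u. u \<in> S \<Longrightarrow> (u, c) \<in> (und A \<inter> (S \<times> S))\<^sup>*"
  shows "connected_on A S"
  unfolding connected_on_def using assms und_sym by (metis rtrancl_trans)

text \<open>Both sides of the cycle at once, as the vertices on any directed path from
  \<open>w\<close> to \<open>p\<close> or \<open>q\<close>. Reachability avoids choosing paths and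
  makes sense as well when several of them lead to \<open>p\<close>.\<close>

definition cycle_set :: "('v \<times> 'v) set \<Rightarrow> 'v \<Rightarrow> 'v \<Rightarrow> 'v \<Rightarrow> 'v \<Rightarrow> 'v set" where
  "cycle_set A w p q h = insert h {u. (w, u) \<in> A\<^sup>* \<and> ((u, p) \<in> A\<^sup>* \<or> (u, q) \<in> A\<^sup>*)}"

text \<open>\<open>h\<close> is a hub that all remaining vertices reach after every deletion but its
  own, and \<open>w\<close> is one after the deletion of \<open>h\<close>. The condition
  \<open>low\<close> keeps the two sides apart, so that an inner vertex of one side leaves the other
  side intact.\<close>

lemma biconnected_cycle_set:
  assumes acyc: "acyclic A" and par: "(p, h) \<in> A" "(q, h) \<in> A"
    and w: "(w, p) \<in> A\<^sup>*" "(w, q) \<in> A\<^sup>*"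
    and low: "\<And>y. (w, y) \<in> A\<^sup>* \<Longrightarrow> (y, p) \<in> A\<^sup>* \<Longrightarrow> (y, q) \<in> A\<^sup>* \<Longrightarrow> y = w"
  shows "biconnected_on A (cycle_set A w p q h)"
proof -
  define W where "W = cycle_set A w p q h"
  have W: "u \<in> W \<longleftrightarrow> u = h \<or> (w, u) \<in> A\<^sup>* \<and> ((u, p) \<in> A\<^sup>* \<or> (u, q) \<in> A\<^sup>*)" for u
    unfolding W_def cycle_set_def by auto
  note anti = rtrancl_antisym[OF acyc]
  have nh: "(h, p) \<notin> A\<^sup>*" "(h, q) \<notin> A\<^sup>*"
    using acyc par by (meson acyclic_def rtrancl_into_trancl2)+
  \<comment> \<open>The deleted vertices form a set \<open>Z\<close>, so that nothing,
    \<open>w\<close> and an inner vertex \<open>z\<close> are handled alike.\<close>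
  have edge: "(u, h) \<in> (und A \<inter> ((W - Z) \<times> (W - Z)))\<^sup>*"
    if "(u, p') \<in> A\<^sup>*" "(w, u) \<in> A\<^sup>*" "p' = p \<or> p' = q" "h \<notin> Z"
      "\<And>y. y \<in> Z \<Longrightarrow> (u, y) \<in> A\<^sup>* \<Longrightarrow> (y, p') \<in> A\<^sup>* \<Longrightarrow> False" for u p' Z
  proof -
    have "(u, p') \<in> (und A \<inter> ((W - Z) \<times> (W - Z)))\<^sup>*"
    proof (rule und_path[OF that(1)])
      fix y assume y: "(u, y) \<in> A\<^sup>*" "(y, p') \<in> A\<^sup>*"
      then have "(w, y) \<in> A\<^sup>*" using that(2) by (meson rtrancl_trans)
      then show "y \<in> W - Z" using y that(3,5) W[of y] by blast
    qed
    moreover have "(p', h) \<in> und A" using that(3) par by (auto simp: und_def)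
    moreover have "p' \<in> W - Z"
      using that(3,5) w W[of p'] that(1) by blast
    moreover have "h \<in> W - Z" using that(4) W by simp
    ultimately show ?thesis by (meson IntI SigmaI rtrancl.rtrancl_into_rtrancl)
  qed
  have hub_h: "(u, h) \<in> (und A \<inter> ((W - Z) \<times> (W - Z)))\<^sup>*" if "Z = {} \<or> Z = {w}" "w \<noteq> h" "u \<in> W - Z" for u Z
  proof (cases "u = h")
    case False
    then have "(w, u) \<in> A\<^sup>*" "(u, p) \<in> A\<^sup>* \<or> (u, q) \<in> A\<^sup>*"
      using \<open>u \<in> W - Z\<close> W[of u] by simp_all
    then obtain p' where p': "p' = p \<or> p' = q" "(u, p') \<in> A\<^sup>*" "(w, u) \<in> A\<^sup>*"
      by metis
    show ?thesis
    proof (rule edge[OF p'(2,3,1)])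
      show "h \<notin> Z" using that by auto
      show False if "y \<in> Z" "(u, y) \<in> A\<^sup>*" for y
        using that \<open>Z = {} \<or> Z = {w}\<close> \<open>u \<in> W - Z\<close> anti[of u w] p'(3) by auto
    qed
  qed simp
  have wh: "w \<noteq> h" using w nh by blast
  have "connected_on A W"
    using connected_on_hub[of W h A] hub_h[of "{}"] wh by auto
  moreover have "connected_on A (W - {w})"
    using connected_on_hub[of "W - {w}" h A] hub_h[of "{w}"] wh by auto
  moreover have "connected_on A (W - {h})"
  proof (rule connected_on_hub[where c = w])
    fix u assume "u \<in> W - {h}"
    then have u: "(w, u) \<in> A\<^sup>*" "(u, p) \<in> A\<^sup>* \<or> (u, q) \<in> A\<^sup>*" using W by auto
    have "(w, u) \<in> (und A \<inter> ((W - {h}) \<times> (W - {h})))\<^sup>*"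
    proof (rule und_path[OF u(1)])
      fix y assume "(w, y) \<in> A\<^sup>*" "(y, u) \<in> A\<^sup>*"
      then have "(w, y) \<in> A\<^sup>* \<and> ((y, p) \<in> A\<^sup>* \<or> (y, q) \<in> A\<^sup>*)"
        using u(2) by (meson rtrancl_trans)
      then show "y \<in> W - {h}" using nh W by blast
    qed
    then show "(u, w) \<in> (und A \<inter> ((W - {h}) \<times> (W - {h})))\<^sup>*" by (rule und_sym)
  qed
  moreover have "connected_on A (W - {z})" if z: "z \<in> W" "z \<noteq> w" "z \<noteq> h" for z
  proof -
    \<comment> \<open>Only one of the two sides of the cycle passes through z; the other one joins w to h.\<close>
    have zW: "(w, z) \<in> A\<^sup>*" "(z, p) \<in> A\<^sup>* \<or> (z, q) \<in> A\<^sup>*"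
      using z W[of z] by simp_all
    then have "\<not> ((z, p) \<in> A\<^sup>* \<and> (z, q) \<in> A\<^sup>*)" using low z(2) by metis
    then obtain p' q' where pq: "(p' = p \<and> q' = q) \<or> (p' = q \<and> q' = p)"
      and z': "(w, z) \<in> A\<^sup>*" "(z, p') \<in> A\<^sup>*" "(z, q') \<notin> A\<^sup>*"
      using zW by metis
    have pq': "p' = p \<or> p' = q" "q' = p \<or> q' = q" "(w, q') \<in> A\<^sup>*" using pq w by auto
    have viaq: "(u, h) \<in> (und A \<inter> ((W - {z}) \<times> (W - {z})))\<^sup>*"
      if "(w, u) \<in> A\<^sup>*" "(u, q') \<in> A\<^sup>*" for u
      using edge[OF that(2,1) pq'(2), of "{z}"] z'(3) z(3) by blast
    show ?thesis
    proof (rule connected_on_hub[where c = h])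
      fix u assume u: "u \<in> W - {z}"
      consider "u = h" | "(w, u) \<in> A\<^sup>*" "(u, q') \<in> A\<^sup>*" | "(w, u) \<in> A\<^sup>*" "(u, p') \<in> A\<^sup>*"
        using u W[of u] pq by blast
      then show "(u, h) \<in> (und A \<inter> ((W - {z}) \<times> (W - {z})))\<^sup>*"
      proof cases
        case 1
        then show ?thesis by simp
      next
        case 2
        then show ?thesis by (rule viaq)
      next
        case 3
        show ?thesis
        \<comment> \<open>From below \<open>z\<close> the way down to \<open>h\<close> avoids
          \<open>z\<close> by acyclicity. Otherwise the way up to \<open>w\<close> avoids
          \<open>z\<close>, and the intact side leads from \<open>w\<close> down to
          \<open>h\<close>.\<close>
        proof (cases "(z, u) \<in> A\<^sup>*")
          case True
          then show ?thesis
            using edge[OF 3(2,1) pq'(1), of "{z}"] anti[of u z] u z(3) by blast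
        next
          case False
          have "(w, u) \<in> (und A \<inter> ((W - {z}) \<times> (W - {z})))\<^sup>*"
          proof (rule und_path[OF 3(1)])
            fix y assume y: "(w, y) \<in> A\<^sup>*" "(y, u) \<in> A\<^sup>*"
            then have "(y, p') \<in> A\<^sup>*" using 3 by (meson rtrancl_trans)
            then show "y \<in> W - {z}" using y False W[of y] pq'(1) by blast
          qed
          then have "(u, w) \<in> (und A \<inter> ((W - {z}) \<times> (W - {z})))\<^sup>*" by (rule und_sym)
          also have "(w, h) \<in> (und A \<inter> ((W - {z}) \<times> (W - {z})))\<^sup>*"
            using viaq[of w] pq'(3) by blast
          finally show ?thesis .
        qed
      qed
    qed
  qed
  ultimately show ?thesis
    unfolding biconnected_on_def W_def[symmetric] using W by blast
qed

lemma card_cycle_set: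
  assumes "finite W" "cycle_set A w p q h \<subseteq> W" "acyclic A" "(p, h) \<in> A" "(q, h) \<in> A" "p \<noteq> q"
    "(w, p) \<in> A\<^sup>*" "(w, q) \<in> A\<^sup>*"
  shows "3 \<le> card W"
proof -
  have "{p, q, h} \<subseteq> W" using assms by (auto simp: cycle_set_def)
  moreover have "p \<noteq> h" "q \<noteq> h" using assms(3-5) by (auto simp: acyclic_def)
  then have "card {p, q, h} = 3" using assms(6) by simp
  ultimately show ?thesis using card_mono[OF assms(1)] by metis
qed

lemma connected_on_crossing:
  assumes "connected_on A S" "u \<in> S" "u \<notin> D" "v \<in> S" "v \<in> D"
  obtains a b where "a \<in> S" "b \<in> S" "a \<notin> D" "b \<in> D" "(a, b) \<in> und A"
proof -
  have "(u, v) \<in> (und A \<inter> (S \<times> S))\<^sup>*" using assms by (auto simp: connected_on_def)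
  then have "v \<in> D \<longrightarrow> (\<exists>a b. a \<in> S \<and> b \<in> S \<and> a \<notin> D \<and> b \<in> D \<and> (a, b) \<in> und A)"
    using assms(3) by (induction rule: rtrancl_induct) auto
  then show ?thesis using assms(5) that by blast
qed

text \<open>Both ends of the bridge lie in \<open>C\<close>. Deleting the end that is on the same
  side as some third vertex cuts this vertex off from the other side. Two adjacent vertices do form
  a biconnected set, hence the bound on \<open>card C\<close>.\<close>

lemma biconnected_no_bridge:
  assumes bic: "biconnected_on A C" and card: "3 \<le> card C"
    and down: "\<And>a b. (a, b) \<in> A \<Longrightarrow> a \<in> D \<Longrightarrow> b \<in> D"
    and bridge: "\<And>a b. (a, b) \<in> A \<Longrightarrow> a \<notin> D \<Longrightarrow> b \<in> D \<Longrightarrow> a = x \<and> b = y"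
    and C: "u \<in> C" "u \<notin> D" "v \<in> C" "v \<in> D"
  shows False
proof -
  have cross: "a = x \<and> b = y" if "(a, b) \<in> und A" "a \<notin> D" "b \<in> D" for a b
    using that down bridge by (auto simp: und_def)
  have "x \<in> C \<and> y \<in> C \<and> x \<notin> D \<and> y \<in> D"
    using connected_on_crossing[of A C u D v] C bic cross unfolding biconnected_on_def by metis
  moreover have "\<not> C \<subseteq> {x, y}"
  proof
    assume "C \<subseteq> {x, y}"
    then have "card C \<le> card {x, y}" by (intro card_mono) auto
    also have "\<dots> \<le> 2" by (simp add: card_insert_if)
    finally show False using card by simp
  qed
  ultimately obtain z where z: "z \<in> C" "z \<noteq> x" "z \<noteq> y" and xy: "x \<in> C" "y \<in> C" "x \<notin> D" "y \<in> D"
    by blast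
  show False
  proof (cases "z \<in> D")
    case True
    have "connected_on A (C - {y})" using bic xy by (auto simp: biconnected_on_def)
    then obtain a b where "a \<in> C - {y}" "b \<in> C - {y}" "a \<notin> D" "b \<in> D" "(a, b) \<in> und A"
      using connected_on_crossing[of A "C - {y}" x D z] True z xy by blast
    then show False using cross by blast
  next
    case False
    have "connected_on A (C - {x})" using bic xy by (auto simp: biconnected_on_def)
    then obtain a b where "a \<in> C - {x}" "b \<in> C - {x}" "a \<notin> D" "b \<in> D" "(a, b) \<in> und A"
      using connected_on_crossing[of A "C - {x}" z D y] False z xy by blast
    then show False using cross by blast
  qed
qed

section \<open>Networks with a single hybrid-vertex and their only cycle\<close>

locale one_hybrid =
  fixes V :: "'v set" and A :: "('v \<times> 'v) set" and r h p q :: 'v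
  assumes fin: "finite V" and sub: "A \<subseteq> V \<times> V" and acyc: "acyclic A"
    and reach: "v \<in> V \<Longrightarrow> (r, v) \<in> A\<^sup>*"
    and uniq: "(a, v) \<in> A \<Longrightarrow> (b, v) \<in> A \<Longrightarrow> v \<noteq> h \<Longrightarrow> a = b"
    and parents: "(a, h) \<in> A \<longleftrightarrow> a = p \<or> a = q"
    and neq: "p \<noteq> q"
begin

lemma finite_arcs: "finite A"
  using fin sub by (meson finite_SigmaI finite_subset)

lemma in_V: "p \<in> V" "q \<in> V" "h \<in> V"
  using parents sub by blast+

lemma ancestor_in_V: "(u, v) \<in> A\<^sup>* \<Longrightarrow> v \<in> V \<Longrightarrow> u \<in> V"
  using sub by (blast elim: converse_rtranclE)

lemma not_above: "(h, p) \<notin> A\<^sup>*" "(h, q) \<notin> A\<^sup>*"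
proof -
  have "(x, h) \<in> A \<Longrightarrow> (h, x) \<notin> A\<^sup>*" for x
    using acyc by (meson acyclic_def rtrancl_into_trancl1)
  then show "(h, p) \<notin> A\<^sup>*" "(h, q) \<notin> A\<^sup>*" using parents by blast+
qed

lemma comparable:
  assumes "(u, x) \<in> A\<^sup>*" "(v, x) \<in> A\<^sup>*" "(h, x) \<notin> A\<^sup>*"
  shows "(u, v) \<in> A\<^sup>* \<or> (v, u) \<in> A\<^sup>*"
proof (rule comparable_ancestors[OF assms(1,2)])
  fix a b c
  assume "(c, x) \<in> A\<^sup>*" "(a, c) \<in> A" "(b, c) \<in> A"
  then show "a = b" using uniq assms(3) by metis
qed

lemma ex_apex:
  obtains w where "(w, p) \<in> A\<^sup>*" "(w, q) \<in> A\<^sup>*"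
    "\<And>u. (u, p) \<in> A\<^sup>* \<Longrightarrow> (u, q) \<in> A\<^sup>* \<Longrightarrow> (u, w) \<in> A\<^sup>*"
proof -
  have "a = b" if "(c, p) \<in> A\<^sup>*" "(a, c) \<in> A" "(b, c) \<in> A" for a b c
    using uniq not_above that by metis
  then show ?thesis
    using ex_lowest_common_ancestor[OF finite_arcs acyc reach[OF in_V(1)] reach[OF in_V(2)]] that
    by metis
qed

context
  fixes w
  assumes apex: "(w, p) \<in> A\<^sup>*" "(w, q) \<in> A\<^sup>*"
    and lowest: "\<And>u. (u, p) \<in> A\<^sup>* \<Longrightarrow> (u, q) \<in> A\<^sup>* \<Longrightarrow> (u, w) \<in> A\<^sup>*"
begin

abbreviation "W \<equiv> cycle_set A w p q h"

lemma W_iff: "u \<in> W \<longleftrightarrow> u = h \<or> (w, u) \<in> A\<^sup>* \<and> ((u, p) \<in> A\<^sup>* \<or> (u, q) \<in> A\<^sup>*)"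
  by (simp add: cycle_set_def)

lemma apex_neq: "w \<noteq> h" using apex(1) not_above by metis

lemma W_subset: "W \<subseteq> V"
  using ancestor_in_V in_V by (auto simp: W_iff)

lemma apex_above_W: "u \<in> W \<Longrightarrow> (w, u) \<in> A\<^sup>*"
  using apex parents by (auto simp: W_iff intro: rtrancl.rtrancl_into_rtrancl)

lemma biconnected_W: "biconnected_on A W"
proof (rule biconnected_cycle_set[OF acyc _ _ apex])
  show "(p, h) \<in> A" "(q, h) \<in> A" using parents by blast+
  fix y assume "(w, y) \<in> A\<^sup>*" "(y, p) \<in> A\<^sup>*" "(y, q) \<in> A\<^sup>*"
  then show "y = w" using lowest rtrancl_antisym[OF acyc] by metis
qed

text \<open>Otherwise \<open>b\<close> has one parent below \<open>c\<close> and one that is not, so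
  \<open>b\<close> is \<open>h\<close> and \<open>c\<close> lies above exactly one of
  \<open>p\<close> and \<open>q\<close>. Comparing \<open>c\<close> with \<open>w\<close> above that
  parent then places \<open>c\<close> on the cycle, strictly below \<open>w\<close>.\<close>

lemma entry:
  assumes c: "c \<noteq> h" "c \<notin> W \<or> c = w"
    and ab: "(a, b) \<in> A" "(c, a) \<notin> A\<^sup>*" "(c, b) \<in> A\<^sup>*"
  shows "b = c"
proof (rule ccontr)
  assume "b \<noteq> c"
  then obtain b' where b': "(c, b') \<in> A\<^sup>*" "(b', b) \<in> A"
    using ab(3) by (metis rtranclE)
  then have "a \<noteq> b'" using ab(2) by metis
  then have "b = h" using uniq ab(1) b'(2) by metis
  then have pq: "(a = p \<and> b' = q) \<or> (a = q \<and> b' = p)"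
    using parents[of a] parents[of b'] ab(1) b'(2) \<open>a \<noteq> b'\<close> by auto
  then have wa: "(w, a) \<in> A\<^sup>*" "(w, b') \<in> A\<^sup>*" "(h, b') \<notin> A\<^sup>*"
    using apex not_above by auto
  then have "(c, w) \<notin> A\<^sup>*" using ab(2) by (meson rtrancl_trans)
  then have "(w, c) \<in> A\<^sup>*" using comparable[OF wa(2) b'(1) wa(3)] by blast
  then have "c \<in> W" using b'(1) pq by (auto simp: W_iff)
  then show False using c(2) wa(1) ab(2) by metis
qed

lemma biconnected_one_side:
  assumes C: "biconnected_on A C" "3 \<le> card C"
    and c: "c \<noteq> h" "c \<notin> W \<or> c = w"
    and v: "v \<in> C" "(c, v) \<in> A\<^sup>*" and u: "u \<in> C"
  shows "(c, u) \<in> A\<^sup>*"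
proof (rule ccontr)
  assume not: "(c, u) \<notin> A\<^sup>*"
  \<comment> \<open>If \<open>c\<close> has no parent, no arc enters its descendants from outside
    and the value of \<open>x\<close> does not matter.\<close>
  define x where "x = (SOME x. (x, c) \<in> A)"
  show False
  proof (rule biconnected_no_bridge[OF C, of "{v. (c, v) \<in> A\<^sup>*}" x c u v])
    fix a b assume ab: "(a, b) \<in> A" "a \<notin> {v. (c, v) \<in> A\<^sup>*}" "b \<in> {v. (c, v) \<in> A\<^sup>*}"
    then have "b = c" using entry[OF c] by simp
    moreover have "(x, c) \<in> A" unfolding x_def using ab \<open>b = c\<close> by (metis someI)
    ultimately show "a = x \<and> b = c" using uniq ab(1) c(1) by metis
  qed (use not u v in \<open>auto intro: rtrancl.rtrancl_into_rtrancl\<close>)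
qed

text \<open>A vertex \<open>c\<close> of \<open>C\<close> outside \<open>W\<close> has all of
  \<open>C\<close> below it. By antisymmetry a second vertex \<open>y\<close> of \<open>C\<close>
  cannot be outside \<open>W\<close> as well. As \<open>y\<close> is below \<open>w\<close>, so is
  all of \<open>C\<close>; hence \<open>c\<close> lies between \<open>w\<close> and the cycle vertex
  \<open>y\<close>, which puts it into \<open>W\<close> after all.\<close>

lemma biconnected_subset_W:
  assumes C: "biconnected_on A C" "3 \<le> card C"
  shows "C \<subseteq> W"
proof (rule ccontr)
  assume "\<not> C \<subseteq> W"
  then obtain c where c: "c \<in> C" "c \<notin> W" by blast
  then have ch: "c \<noteq> h" by (auto simp: W_iff)
  have below: "(c, u) \<in> A\<^sup>*" if "u \<in> C" for u
    using biconnected_one_side[OF C ch _ c(1) _ that] c by blast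
  have "\<not> C \<subseteq> {c}"
  proof
    assume "C \<subseteq> {c}"
    then have "card C \<le> 1" using card_mono[of "{c}" C] by simp
    then show False using C(2) by simp
  qed
  then obtain y where y: "y \<in> C" "y \<noteq> c" by blast
  have "y \<in> W"
  proof (rule ccontr)
    assume yW: "y \<notin> W"
    then have "y \<noteq> h" by (auto simp: W_iff)
    then have "(y, c) \<in> A\<^sup>*"
      using biconnected_one_side[OF C, of y y c] yW y(1) c(1) by blast
    then show False using below[OF y(1)] y(2) rtrancl_antisym[OF acyc] by metis
  qed
  then have "(w, y) \<in> A\<^sup>*" by (rule apex_above_W)
  then have wc: "(w, c) \<in> A\<^sup>*"
    using biconnected_one_side[OF C apex_neq _ y(1) _ c(1)] by blast
  have "(c, p) \<in> A\<^sup>* \<or> (c, q) \<in> A\<^sup>*"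
  proof (cases "y = h")
    case True
    then obtain z where "(c, z) \<in> A\<^sup>*" "(z, h) \<in> A"
      using below[OF y(1)] y(2) by (metis rtranclE)
    then show ?thesis using parents by metis
  next
    case False
    then show ?thesis using \<open>y \<in> W\<close> below[OF y(1)] by (meson W_iff rtrancl_trans)
  qed
  then show False using wc c(2) by (simp add: W_iff)
qed

lemma card_W: "3 \<le> card W"
  using card_cycle_set[OF finite_subset[OF W_subset fin] order_refl acyc _ _ neq apex] parents by blast

lemma cycles_eq: "{C. is_cycle V A C} = {W}"
proof -
  have "is_cycle V A W"
    unfolding is_cycle_def is_block_def
  proof (intro conjI allI impI W_subset biconnected_W card_W)
    fix W' assume W': "W \<subseteq> W' \<and> W' \<subseteq> V \<and> biconnected_on A W'"
    then have "3 \<le> card W'"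
      using card_W card_mono[of W' W] finite_subset[OF _ fin, of W'] by simp
    then show "W' = W" using biconnected_subset_W W' by blast
  qed
  moreover have "C = W" if "is_cycle V A C" for C
  proof -
    have "C \<subseteq> W" using that biconnected_subset_W by (simp add: is_cycle_def is_block_def)
    then show ?thesis using that biconnected_W W_subset unfolding is_cycle_def is_block_def by metis
  qed
  ultimately show ?thesis by blast
qed

lemma cycle_root_W: "cycle_root A W = w"
  unfolding cycle_root_def
proof (rule the_equality)
  have "(u, w) \<notin> A" if "u \<in> W" for u
    using apex_above_W[OF that] acyc by (meson acyclic_def rtrancl_into_trancl1)
  then show "w \<in> W \<and> (\<forall>u\<in>W. (u, w) \<notin> A)"
    using apex by (simp add: W_iff)
next
  fix z assume z: "z \<in> W \<and> (\<forall>u\<in>W. (u, z) \<notin> A)"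
  show "z = w"
  proof (rule ccontr)
    assume "z \<noteq> w"
    have "p \<in> W" using apex by (simp add: W_iff)
    then have zh: "z \<noteq> h" using z parents by blast
    obtain y where y: "(w, y) \<in> A\<^sup>*" "(y, z) \<in> A"
      using apex_above_W z \<open>z \<noteq> w\<close> by (metis rtranclE)
    then have "(y, p) \<in> A\<^sup>* \<or> (y, q) \<in> A\<^sup>*"
      using z zh by (meson W_iff converse_rtrancl_into_rtrancl)
    then show False using z y by (simp add: W_iff)
  qed
qed

end

end

section \<open>Graphs without induced path on four vertices: disconnecting the graph or its
  complement\<close>

definition splits :: "'a set \<Rightarrow> ('a \<Rightarrow> 'a \<Rightarrow> bool) \<Rightarrow> 'a set \<Rightarrow> 'a set \<Rightarrow> bool \<Rightarrow> bool" where
  "splits S E A B c \<longleftrightarrow>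
     A \<union> B = S \<and> A \<inter> B = {} \<and> A \<noteq> {} \<and> B \<noteq> {} \<and> (\<forall>x\<in>A. \<forall>y\<in>B. E x y = c)"

lemma splits_commute:
  assumes "symp E" "splits S E A B c"
  shows "splits S E B A c"
proof -
  have "E x y = E y x" for x y using assms(1) by (auto dest: sympD)
  then show ?thesis using assms(2) unfolding splits_def by (metis Int_commute Un_commute)
qed

text \<open>The complement of the path \<open>a b c d\<close> is the path
  \<open>b d a c\<close>.\<close>

lemma p4free_complement:
  assumes "symp E" "p4free S E"
  shows "p4free S (\<lambda>x y. \<not> E x y)"
  unfolding p4free_def
proof clarify
  fix a b c d
  assume "a \<in> S" "b \<in> S" "c \<in> S" "d \<in> S" "distinct [a, b, c, d]"
    "\<not> E a b" "\<not> E b c" "\<not> E c d" "E a c" "E b d" "E a d"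
  moreover from this have "E d a" "\<not> E b a" "\<not> E d c" "distinct [b, d, a, c]"
    using assms(1) by (auto dest: sympD)
  ultimately show False using assms(2) unfolding p4free_def by blast
qed

text \<open>A split with \<open>False\<close> disconnects the graph, one with \<open>True\<close>
  its complement. If the new vertex \<open>z\<close> is adjacent to everything, it splits off.
  Otherwise the component of some non-neighbour \<open>n\<close> decides: either \<open>z\<close>
  has no neighbour inside it, or none outside it, or an induced path through \<open>z\<close>
  arises.\<close>

lemma splits_insert:
  assumes sym: "symp E" and fin: "finite S" and free: "p4free (insert z S) E" and z: "z \<notin> S"
    and split: "splits S E A0 B0 False"
  shows "\<exists>A B c. splits (insert z S) E A B c"
proof (cases "\<forall>x\<in>S. E x z")
  case True
  then have "splits (insert z S) E S {z} True"
    using split z unfolding splits_def by auto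
  then show ?thesis by blast
next
  case False
  then obtain n where n: "n \<in> S" "\<not> E n z" by blast
  \<comment> \<open>The closed sets are the unions of components that contain \<open>n\<close>. The
    component of \<open>n\<close> is obtained as one of least cardinality, so that minimality takes
    the place of walks.\<close>
  define closed where "closed K \<longleftrightarrow> K \<subseteq> S \<and> n \<in> K \<and> (\<forall>x\<in>K. \<forall>y\<in>S - K. \<not> E x y)" for K
  have "closed A0 \<or> closed B0"
    using split n sym unfolding splits_def closed_def symp_def by blast
  then obtain K0 where K0: "closed K0" "K0 \<noteq> S"
    using split unfolding splits_def by blast
  define K where "K = arg_min card closed"
  have K: "closed K" unfolding K_def using K0(1) by (rule arg_min_natI)
  have min: "card K \<le> card K'" if "closed K'" for K'
    unfolding K_def using that by (rule arg_min_nat_le)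
  have KS: "K \<subseteq> S" "n \<in> K" and cross: "\<And>x y. x \<in> K \<Longrightarrow> y \<in> S - K \<Longrightarrow> \<not> E x y"
    using K unfolding closed_def by blast+
  have "K \<noteq> S"
  proof
    assume "K = S"
    moreover have "K0 \<subset> S" using K0 unfolding closed_def by blast
    then have "card K0 < card S" using fin by (simp add: psubset_card_mono)
    ultimately show False using min[OF K0(1)] by simp
  qed
  consider "\<forall>x\<in>K. \<not> E x z" | "\<forall>x\<in>S - K. \<not> E x z"
    | a b where "a \<in> K" "E a z" "b \<in> S - K" "E b z" by blast
  then show ?thesis
  proof cases
    case 1
    then have "splits (insert z S) E K (insert z (S - K)) False"
      using KS cross z unfolding splits_def by blast
    then show ?thesis by blast
  next
    case 2
    then have "splits (insert z S) E (S - K) (insert z K) False"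
      using KS cross z sym \<open>K \<noteq> S\<close> unfolding splits_def symp_def by blast
    then show ?thesis by blast
  next
    case 3
    \<comment> \<open>By minimality some neighbour u of z in K has a neighbour u' in K that is not adjacent
      to z; then b, z, u, u' is an induced path.\<close>
    let ?K' = "{x \<in> K. \<not> E x z}"
    have "?K' \<subset> K" using 3 by blast
    then have "card ?K' < card K" using KS fin finite_subset[OF KS(1)] by (simp add: psubset_card_mono)
    then have "\<not> closed ?K'" using min by fastforce
    then obtain u' u where u: "u' \<in> K" "\<not> E u' z" "u \<in> S" "E u' u" "u \<notin> ?K'"
      using KS n(2) unfolding closed_def by blast
    then have "u \<in> K" "E u z" using cross by blast+
    have "b \<in> insert z S" "z \<in> insert z S" "u \<in> insert z S" "u' \<in> insert z S"
      using u KS 3 by auto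
    moreover have "distinct [b, z, u, u']"
      using u \<open>u \<in> K\<close> \<open>E u z\<close> 3 KS z by auto
    moreover have "E b z" "E z u" "E u u'" "\<not> E b u" "\<not> E z u'" "\<not> E b u'"
      using u \<open>u \<in> K\<close> \<open>E u z\<close> 3 cross sym by (auto dest: sympD)
    ultimately show ?thesis using free unfolding p4free_def by blast
  qed
qed

text \<open>Induction on the vertices. If the smaller graph splits with all edges across, its
  complement is disconnected, and \<open>splits_insert\<close> is applied to the complement;
  negating \<open>c\<close> translates the result back.\<close>

lemma p4free_splits:
  assumes "symp E" "finite S" "2 \<le> card S" "p4free S E"
  shows "\<exists>A B c. splits S E A B c"
  using assms(2-)
proof (induction S rule: finite_induct)
  case empty
  then show ?case by simp
next
  case (insert z S)
  show ?case
  proof (cases "2 \<le> card S")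
    case True
    then obtain A B c where ABc: "splits S E A B c"
      using insert p4free_subset[OF insert.prems(2), of S] by blast
    show ?thesis
    proof (cases c)
      case False
      then show ?thesis
        using splits_insert[OF assms(1) insert.hyps(1) insert.prems(2) insert.hyps(2)] ABc by simp
    next
      case True
      let ?E = "\<lambda>x y. \<not> E x y"
      have "symp ?E" using assms(1) by (auto simp: symp_def)
      moreover have "splits S ?E A B False" using ABc True by (simp add: splits_def)
      ultimately obtain A' B' c' where "splits (insert z S) ?E A' B' c'"
        using splits_insert[OF _ insert.hyps(1) p4free_complement[OF assms(1) insert.prems(2)] insert.hyps(2)]
        by blast
      then have "splits (insert z S) E A' B' (\<not> c')" unfolding splits_def by blast
      then show ?thesis by blast
    qed
  next
    case False
    then have "card S = 1" using insert by simp
    then obtain y where "S = {y}" by (auto simp: card_1_singleton_iff)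
    then have "splits (insert z S) E {z} {y} (E z y)" using insert.hyps by (auto simp: splits_def)
    then show ?thesis by blast
  qed
qed

section \<open>Pseudo-cographs in terms of adjacency\<close>

lemma del_vertex_glued:
  assumes "fst G = V1 \<union> V2" "V1 \<inter> V2 = {v}"
  shows "del_vertex G v = ((V1 - {v}) \<union> (V2 - {v}),
      snd G \<inter> (((V1 - {v}) \<union> (V2 - {v})) \<times> ((V1 - {v}) \<union> (V2 - {v}))))"
    and "del_vertex (induced G V1) v = (V1 - {v}, snd G \<inter> ((V1 - {v}) \<times> (V1 - {v})))"
    and "del_vertex (induced G V2) v = (V2 - {v}, snd G \<inter> ((V2 - {v}) \<times> (V2 - {v})))"
proof -
  have "fst G - {v} = (V1 - {v}) \<union> (V2 - {v})" using assms by auto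
  then show "del_vertex G v = ((V1 - {v}) \<union> (V2 - {v}),
      snd G \<inter> (((V1 - {v}) \<union> (V2 - {v})) \<times> ((V1 - {v}) \<union> (V2 - {v}))))"
    unfolding del_vertex_def induced_def by simp
qed (auto simp: del_vertex_def induced_def)

lemma del_vertex_gjoin_iff:
  assumes "is_graph G" "fst G = V1 \<union> V2" "V1 \<inter> V2 = {v}"
  shows "del_vertex G v = gjoin (del_vertex (induced G V1) v) (del_vertex (induced G V2) v) \<longleftrightarrow>
    (\<forall>x\<in>V1 - {v}. \<forall>y\<in>V2 - {v}. (x, y) \<in> snd G)"
proof -
  have sym: "(a, b) \<in> snd G \<longleftrightarrow> (b, a) \<in> snd G" for a b
    using assms(1) by (auto simp: is_graph_def dest: symD)
  have "E \<inter> ((U1 \<union> U2) \<times> (U1 \<union> U2)) = E \<inter> (U1 \<times> U1) \<union> E \<inter> (U2 \<times> U2) \<union> U1 \<times> U2 \<union> U2 \<times> U1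
      \<longleftrightarrow> (\<forall>x\<in>U1. \<forall>y\<in>U2. (x, y) \<in> E)"
    if "\<And>a b. (a, b) \<in> E \<longleftrightarrow> (b, a) \<in> E" for E :: "('a \<times> 'a) set" and U1 U2
    using that by blast
  from this[OF sym, of "V1 - {v}" "V2 - {v}"] show ?thesis
    unfolding del_vertex_glued[OF assms(2,3)] gjoin_def by simp
qed

lemma del_vertex_disj_union_iff:
  assumes "is_graph G" "fst G = V1 \<union> V2" "V1 \<inter> V2 = {v}"
  shows "del_vertex G v = disj_union (del_vertex (induced G V1) v) (del_vertex (induced G V2) v) \<longleftrightarrow>
    (\<forall>x\<in>V1 - {v}. \<forall>y\<in>V2 - {v}. (x, y) \<notin> snd G)"
proof -
  have sym: "(a, b) \<in> snd G \<longleftrightarrow> (b, a) \<in> snd G" for a b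
    using assms(1) by (auto simp: is_graph_def dest: symD)
  have "E \<inter> ((U1 \<union> U2) \<times> (U1 \<union> U2)) = E \<inter> (U1 \<times> U1) \<union> E \<inter> (U2 \<times> U2)
      \<longleftrightarrow> (\<forall>x\<in>U1. \<forall>y\<in>U2. (x, y) \<notin> E)"
    if "\<And>a b. (a, b) \<in> E \<longleftrightarrow> (b, a) \<in> E" "U1 \<inter> U2 = {}" for E :: "('a \<times> 'a) set" and U1 U2
    using that by blast
  moreover have "(V1 - {v}) \<inter> (V2 - {v}) = {}" using assms(3) by auto
  ultimately show ?thesis
    unfolding del_vertex_glued[OF assms(2,3)] disj_union_def using sym by simp
qed

text \<open>Join and disjoint union become the two values of one truth value \<open>c\<close> for
  adjacency across the parts. It is the label of the root in the corresponding network.\<close>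

lemma pseudo_cograph_iff:
  assumes "is_graph G"
  shows "pseudo_cograph G \<longleftrightarrow> card (fst G) \<le> 2 \<or>
    (\<exists>V1 V2 v c. fst G = V1 \<union> V2 \<and> V1 \<inter> V2 = {v} \<and> card V1 > 1 \<and> card V2 > 1 \<and>
       p4free V1 (\<lambda>x y. (x, y) \<in> snd G) \<and> p4free V2 (\<lambda>x y. (x, y) \<in> snd G) \<and>
       (\<forall>x\<in>V1 - {v}. \<forall>y\<in>V2 - {v}. (x, y) \<in> snd G \<longleftrightarrow> c))" (is "_ \<longleftrightarrow> _ \<or> ?R")
proof -
  have "(\<exists>V1 V2 v. V1 \<subseteq> fst G \<and> V2 \<subseteq> fst G \<and>
       fst G = V1 \<union> V2 \<and> V1 \<inter> V2 = {v} \<and> card V1 > 1 \<and> card V2 > 1 \<and>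
       cograph (induced G V1) \<and> cograph (induced G V2) \<and>
       (del_vertex G v = gjoin (del_vertex (induced G V1) v) (del_vertex (induced G V2) v) \<or>
        del_vertex G v = disj_union (del_vertex (induced G V1) v) (del_vertex (induced G V2) v)))
     \<longleftrightarrow> (\<exists>V1 V2 v. fst G = V1 \<union> V2 \<and> V1 \<inter> V2 = {v} \<and> card V1 > 1 \<and> card V2 > 1 \<and>
       p4free V1 (\<lambda>x y. (x, y) \<in> snd G) \<and> p4free V2 (\<lambda>x y. (x, y) \<in> snd G) \<and>
       (\<exists>c. \<forall>x\<in>V1 - {v}. \<forall>y\<in>V2 - {v}. (x, y) \<in> snd G \<longleftrightarrow> c))"
    (is "(\<exists>V1 V2 v. ?P V1 V2 v) \<longleftrightarrow> (\<exists>V1 V2 v. ?Q V1 V2 v)")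
  proof -
    have "?P V1 V2 v \<longleftrightarrow> ?Q V1 V2 v" for V1 V2 v
    proof (cases "fst G = V1 \<union> V2 \<and> V1 \<inter> V2 = {v}")
      case True
      then show ?thesis
        using del_vertex_gjoin_iff[OF assms, of V1 V2 v] del_vertex_disj_union_iff[OF assms, of V1 V2 v]
        by (simp add: cograph_induced_iff ex_bool_eq)
    next
      case False
      then show ?thesis by metis
    qed
    then show ?thesis by simp
  qed
  then show ?thesis unfolding pseudo_cograph_def by simp
qed

text \<open>Any vertex \<open>v\<close> in a split part with at least two elements can serve as the
  shared vertex, by adding it to the other part. This settles networks without hybrid-vertex and
  those in which one part would be only \<open>{v}\<close>.\<close>

lemma p4free_pseudo_cograph:
  assumes "is_graph G" "p4free (fst G) (\<lambda>x y. (x, y) \<in> snd G)"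
  shows "pseudo_cograph G"
proof (cases "card (fst G) \<le> 2")
  case True
  then show ?thesis by (simp add: pseudo_cograph_def)
next
  case False
  let ?E = "\<lambda>x y. (x, y) \<in> snd G"
  have sym: "symp ?E" and fin: "finite (fst G)"
    using assms(1) by (auto simp: is_graph_def sym_def symp_def)
  obtain A0 B0 c where AB0: "splits (fst G) ?E A0 B0 c"
    using p4free_splits[OF sym fin _ assms(2)] False by auto
  have "card A0 + card B0 = card (fst G)"
    using AB0 fin by (metis card_Un_disjoint finite_Un splits_def)
  then have "2 \<le> card A0 \<or> 2 \<le> card B0" using False by linarith
  then obtain A B where AB: "splits (fst G) ?E A B c" "2 \<le> card A"
    using AB0 splits_commute[OF sym] by blast
  have finAB: "finite A" "finite B" using fin AB(1) by (metis finite_Un splits_def)+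
  obtain v where v: "v \<in> A" using AB(2) by fastforce
  then have "v \<notin> B" "B \<noteq> {}" using AB(1) by (auto simp: splits_def)
  then have "1 < card (insert v B)" using finAB by (simp add: card_gt_0_iff)
  moreover have "A \<union> insert v B = fst G" "A \<inter> insert v B = {v}"
    using v AB(1) by (auto simp: splits_def)
  moreover from this have "p4free A ?E" "p4free (insert v B) ?E"
    using assms(2) by (auto intro: p4free_subset)
  moreover have "\<forall>x\<in>A - {v}. \<forall>y\<in>insert v B - {v}. (x, y) \<in> snd G \<longleftrightarrow> c"
    using AB(1) by (auto simp: splits_def)
  ultimately show ?thesis
    unfolding pseudo_cograph_iff[OF assms(1)] using AB(2)
    by (intro disjI2 exI[of _ A] exI[of _ "insert v B"] exI[of _ v] exI[of _ c]) auto
qed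

section \<open>Cotrees\<close>

text \<open>Numbers increase along arcs, which gives acyclicity, room for a new root below, and room
  for a disjoint second tree above. \<open>E\<close> relates leaves and not vertices of a graph,
  because two leaves of one tree will stand for the same graph vertex and must be told
  apart.\<close>

locale cotree =
  fixes V :: "nat set" and B :: "(nat \<times> nat) set" and r :: nat and L :: "nat set"
    and t :: "nat \<Rightarrow> bool" and E :: "nat \<Rightarrow> nat \<Rightarrow> bool"
  assumes fin: "finite V" and sub: "B \<subseteq> V \<times> V" and incr: "(a, b) \<in> B \<Longrightarrow> a < b"
    and root: "r \<in> V" and reach: "v \<in> V \<Longrightarrow> (r, v) \<in> B\<^sup>*"
    and uniq: "(a, v) \<in> B \<Longrightarrow> (b, v) \<in> B \<Longrightarrow> a = b"
    and leaf: "x \<in> L \<longleftrightarrow> x \<in> V \<and> (\<forall>c. (x, c) \<notin> B)"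
    and inner: "v \<in> V \<Longrightarrow> v \<notin> L \<Longrightarrow> \<exists>c d. c \<noteq> d \<and> (v, c) \<in> B \<and> (v, d) \<in> B"
    and lca: "x \<in> L \<Longrightarrow> y \<in> L \<Longrightarrow> x \<noteq> y \<Longrightarrow> \<exists>m. (m, x) \<in> B\<^sup>* \<and> (m, y) \<in> B\<^sup>* \<and>
      (\<forall>w. (w, x) \<in> B\<^sup>* \<and> (w, y) \<in> B\<^sup>* \<longrightarrow> (w, m) \<in> B\<^sup>*) \<and> (t m \<longleftrightarrow> E x y)"
begin

lemma path_le: "(a, b) \<in> B\<^sup>* \<Longrightarrow> a \<le> b"
  by (induction rule: rtrancl_induct) (auto dest: incr)

lemma root_no_parent: "(a, r) \<notin> B"
proof
  assume "(a, r) \<in> B"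
  then have "r \<le> a" "a < r" using path_le reach sub incr by blast+
  then show False by simp
qed

lemma acyclic: "acyclic B"
proof -
  have "(a, b) \<in> B\<^sup>+ \<Longrightarrow> a < b" for a b
    by (induction rule: trancl_induct) (auto dest: incr)
  then show ?thesis by (auto simp: acyclic_def)
qed

lemma leaf_subset: "L \<subseteq> V"
  using leaf by blast

lemma ex_parent:
  assumes "v \<in> V" "v \<noteq> r"
  obtains u where "(u, v) \<in> B"
  using reach[OF assms(1)] assms(2) by (metis rtranclE)

end

lemma cotree_leaf: "cotree {k} {} k {k} t E"
  by unfold_locales auto

lemma cotree_cong:
  assumes "cotree V B r L t E" "\<And>x y. x \<in> L \<Longrightarrow> y \<in> L \<Longrightarrow> x \<noteq> y \<Longrightarrow> E x y = E' x y"
    "\<And>v. v \<in> V \<Longrightarrow> t v = t' v"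
  shows "cotree V B r L t' E'"
proof -
  interpret cotree V B r L t E by fact
  show ?thesis
  proof (unfold_locales; (fact fin sub root incr reach uniq leaf inner)?)
    fix x y assume xy: "x \<in> L" "y \<in> L" "x \<noteq> y"
    then obtain m where m: "(m, x) \<in> B\<^sup>*" "(m, y) \<in> B\<^sup>*"
      "\<forall>w. (w, x) \<in> B\<^sup>* \<and> (w, y) \<in> B\<^sup>* \<longrightarrow> (w, m) \<in> B\<^sup>*" "t m \<longleftrightarrow> E x y"
      using lca by blast
    have "m \<in> V" using m(1) xy(1) sub leaf_subset by (blast elim: converse_rtranclE)
    then show "\<exists>m. (m, x) \<in> B\<^sup>* \<and> (m, y) \<in> B\<^sup>* \<and>
      (\<forall>w. (w, x) \<in> B\<^sup>* \<and> (w, y) \<in> B\<^sup>* \<longrightarrow> (w, m) \<in> B\<^sup>*) \<and> (t' m \<longleftrightarrow> E' x y)"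
      using m assms(2)[OF xy] assms(3) by metis
  qed
qed

lemma ancestors_in_part:
  assumes "(w, x) \<in> B\<^sup>*" "x \<in> V'" "B' \<subseteq> V' \<times> V'"
    and "\<And>a b. (a, b) \<in> B \<Longrightarrow> b \<in> V' \<Longrightarrow> a = k \<or> (a, b) \<in> B'" "\<And>a. (a, k) \<notin> B"
  shows "w = k \<or> (w, x) \<in> B'\<^sup>* \<and> w \<in> V'"
  using assms(1)
proof (induction rule: converse_rtrancl_induct)
  case base
  then show ?case using assms(2) by simp
next
  case (step a b)
  then have "(b, x) \<in> B'\<^sup>*" "b \<in> V'" using assms(5) by blast+
  then show ?case
    using assms(3,4) step.hyps(1) by (meson SigmaD1 converse_rtrancl_into_rtrancl subsetD)
qed

text \<open>Serves twice: as the inductive step in building a cotree, and to join the cotrees of the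
  two parts of a pseudo-cograph.\<close>

locale glued_cotrees =
  T1: cotree V1 B1 r1 L1 t E + T2: cotree V2 B2 r2 L2 t E
  for V1 B1 r1 L1 V2 B2 r2 L2 t E +
  fixes k :: nat
  assumes disjoint: "V1 \<inter> V2 = {}" and below: "v \<in> V1 \<union> V2 \<Longrightarrow> k < v"
    and cross_label: "x \<in> L1 \<Longrightarrow> y \<in> L2 \<Longrightarrow> E x y = t k \<and> E y x = t k"
begin

abbreviation "V \<equiv> insert k (V1 \<union> V2)"

abbreviation "B \<equiv> {(k, r1), (k, r2)} \<union> B1 \<union> B2"

lemma k_notin: "k \<notin> V1" "k \<notin> V2"
  using below by blast+

lemma no_edge_to_k: "(a, k) \<notin> B"
  using k_notin T1.sub T2.sub T1.root T2.root by auto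

lemma edge_left: "(a, b) \<in> B \<Longrightarrow> b \<in> V1 \<Longrightarrow> a = k \<and> b = r1 \<or> (a, b) \<in> B1"
  using T2.sub T2.root disjoint by auto

lemma edge_right: "(a, b) \<in> B \<Longrightarrow> b \<in> V2 \<Longrightarrow> a = k \<and> b = r2 \<or> (a, b) \<in> B2"
  using T1.sub T1.root disjoint by auto

lemma ancestors_left: "(w, x) \<in> B\<^sup>* \<Longrightarrow> x \<in> V1 \<Longrightarrow> w = k \<or> (w, x) \<in> B1\<^sup>* \<and> w \<in> V1"
  using ancestors_in_part[of w x B V1 B1 k] edge_left no_edge_to_k T1.sub by blast

lemma ancestors_right: "(w, x) \<in> B\<^sup>* \<Longrightarrow> x \<in> V2 \<Longrightarrow> w = k \<or> (w, x) \<in> B2\<^sup>* \<and> w \<in> V2"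
  using ancestors_in_part[of w x B V2 B2 k] edge_right no_edge_to_k T2.sub by blast

lemma path_left: "(a, b) \<in> B1\<^sup>* \<Longrightarrow> (a, b) \<in> B\<^sup>*"
  by (rule rtrancl_mono[THEN subsetD, rotated]) auto

lemma path_right: "(a, b) \<in> B2\<^sup>* \<Longrightarrow> (a, b) \<in> B\<^sup>*"
  by (rule rtrancl_mono[THEN subsetD, rotated]) auto

lemma glued_reach: "v \<in> V \<Longrightarrow> (k, v) \<in> B\<^sup>*"
proof (elim insertE UnE)
  assume "v \<in> V1"
  then have "(r1, v) \<in> B\<^sup>*" by (intro path_left T1.reach)
  then show ?thesis by (intro converse_rtrancl_into_rtrancl[of k r1]) auto
next
  assume "v \<in> V2"
  then have "(r2, v) \<in> B\<^sup>*" by (intro path_right T2.reach)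
  then show ?thesis by (intro converse_rtrancl_into_rtrancl[of k r2]) auto
qed simp

lemma cross_ancestor:
  assumes "x \<in> V1" "y \<in> V2" "(w, x) \<in> B\<^sup>*" "(w, y) \<in> B\<^sup>*"
  shows "w = k"
  using ancestors_left[OF assms(3,1)] ancestors_right[OF assms(4,2)] disjoint by blast

lemma glued_lca_left:
  assumes "x \<in> L1" "y \<in> L1" "x \<noteq> y"
  shows "\<exists>m. (m, x) \<in> B\<^sup>* \<and> (m, y) \<in> B\<^sup>* \<and>
      (\<forall>w. (w, x) \<in> B\<^sup>* \<and> (w, y) \<in> B\<^sup>* \<longrightarrow> (w, m) \<in> B\<^sup>*) \<and> (t m \<longleftrightarrow> E x y)"
proof -
  obtain m where m: "(m, x) \<in> B1\<^sup>*" "(m, y) \<in> B1\<^sup>*"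
    "\<And>w. (w, x) \<in> B1\<^sup>* \<Longrightarrow> (w, y) \<in> B1\<^sup>* \<Longrightarrow> (w, m) \<in> B1\<^sup>*" "t m \<longleftrightarrow> E x y"
    using T1.lca[OF assms] by blast
  have V1: "x \<in> V1" "y \<in> V1" "m \<in> V1"
    using assms m(1) T1.leaf_subset T1.sub by (blast elim: converse_rtranclE)+
  have "(w, m) \<in> B\<^sup>*" if "(w, x) \<in> B\<^sup>*" "(w, y) \<in> B\<^sup>*" for w
    using ancestors_left[OF that(1) V1(1)] ancestors_left[OF that(2) V1(2)] m(3)[of w]
      path_left[of w m] glued_reach[of m] V1(3) by auto
  then show ?thesis using m path_left by blast
qed

lemma glued_lca_right:
  assumes "x \<in> L2" "y \<in> L2" "x \<noteq> y"
  shows "\<exists>m. (m, x) \<in> B\<^sup>* \<and> (m, y) \<in> B\<^sup>* \<and>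
      (\<forall>w. (w, x) \<in> B\<^sup>* \<and> (w, y) \<in> B\<^sup>* \<longrightarrow> (w, m) \<in> B\<^sup>*) \<and> (t m \<longleftrightarrow> E x y)"
proof -
  obtain m where m: "(m, x) \<in> B2\<^sup>*" "(m, y) \<in> B2\<^sup>*"
    "\<And>w. (w, x) \<in> B2\<^sup>* \<Longrightarrow> (w, y) \<in> B2\<^sup>* \<Longrightarrow> (w, m) \<in> B2\<^sup>*" "t m \<longleftrightarrow> E x y"
    using T2.lca[OF assms] by blast
  have V2: "x \<in> V2" "y \<in> V2" "m \<in> V2"
    using assms m(1) T2.leaf_subset T2.sub by (blast elim: converse_rtranclE)+
  have "(w, m) \<in> B\<^sup>*" if "(w, x) \<in> B\<^sup>*" "(w, y) \<in> B\<^sup>*" for w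
    using ancestors_right[OF that(1) V2(1)] ancestors_right[OF that(2) V2(2)] m(3)[of w]
      path_right[of w m] glued_reach[of m] V2(3) by auto
  then show ?thesis using m path_right by blast
qed

lemma glued_lca_cross:
  assumes "x \<in> L1" "y \<in> L2"
  shows "(k, x) \<in> B\<^sup>* \<and> (k, y) \<in> B\<^sup>* \<and> (\<forall>w. (w, x) \<in> B\<^sup>* \<and> (w, y) \<in> B\<^sup>* \<longrightarrow> (w, k) \<in> B\<^sup>*)"
  using assms glued_reach T1.leaf_subset T2.leaf_subset cross_ancestor by blast

lemma glued_cotree: "cotree V B k (L1 \<union> L2) t E"
proof
  show "finite V" using T1.fin T2.fin by simp
  show "B \<subseteq> V \<times> V" using T1.sub T2.sub T1.root T2.root by auto
  show "k \<in> V" by simp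
  show "(k, v) \<in> B\<^sup>*" if "v \<in> V" for v by (rule glued_reach[OF that])
  show "a < b" if "(a, b) \<in> B" for a b
    using that T1.incr T2.incr below T1.root T2.root by auto
  show "a = b" if ab: "(a, v) \<in> B" "(b, v) \<in> B" for a b v
  proof -
    have "v \<in> V1 \<or> v \<in> V2" using ab(1) T1.sub T2.sub T1.root T2.root by auto
    then show ?thesis
    proof
      assume v: "v \<in> V1"
      then show ?thesis
        using edge_left[OF ab(1) v] edge_left[OF ab(2) v] T1.uniq T1.root_no_parent by metis
    next
      assume v: "v \<in> V2"
      then show ?thesis
        using edge_right[OF ab(1) v] edge_right[OF ab(2) v] T2.uniq T2.root_no_parent by metis
    qed
  qed
  show "x \<in> L1 \<union> L2 \<longleftrightarrow> x \<in> V \<and> (\<forall>c. (x, c) \<notin> B)" for x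
    using T1.leaf[of x] T2.leaf[of x] k_notin disjoint T1.sub T2.sub by blast
  show "\<exists>c d. c \<noteq> d \<and> (v, c) \<in> B \<and> (v, d) \<in> B" if v: "v \<in> V" "v \<notin> L1 \<union> L2" for v
  proof -
    have "r1 \<noteq> r2" using T1.root T2.root disjoint by blast
    then show ?thesis using v T1.inner[of v] T2.inner[of v] by blast
  qed
  show "\<exists>m. (m, x) \<in> B\<^sup>* \<and> (m, y) \<in> B\<^sup>* \<and>
      (\<forall>w. (w, x) \<in> B\<^sup>* \<and> (w, y) \<in> B\<^sup>* \<longrightarrow> (w, m) \<in> B\<^sup>*) \<and> (t m \<longleftrightarrow> E x y)"
    if xy: "x \<in> L1 \<union> L2" "y \<in> L1 \<union> L2" "x \<noteq> y" for x y
  proof -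
    consider "x \<in> L1" "y \<in> L1" | "x \<in> L2" "y \<in> L2" | "x \<in> L1" "y \<in> L2" | "x \<in> L2" "y \<in> L1"
      using xy by blast
    then show ?thesis
    proof cases
      case 1
      then show ?thesis using glued_lca_left xy(3) by blast
    next
      case 2
      then show ?thesis using glued_lca_right xy(3) by blast
    next
      case 3
      then show ?thesis using glued_lca_cross[OF 3] cross_label[OF 3] by metis
    next
      case 4
      then show ?thesis using glued_lca_cross[OF 4(2,1)] cross_label[OF 4(2,1)] by metis
    qed
  qed
qed

end

text \<open>Each split yields a root labelled \<open>c\<close> above the cotrees of its two sides.
  The lower bound \<open>k\<close> on the vertex numbers is generalized in the induction, since the
  subtrees have to leave \<open>k\<close> itself to the new root.\<close>

lemma ex_cotree:
  assumes "symp adj" "finite S" "S \<noteq> {}" "p4free S adj"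
  shows "\<exists>V B r L t g. cotree V B r L t (\<lambda>x y. adj (g x) (g y)) \<and> bij_betw g L S \<and> V \<subseteq> {k..}"
  using assms(2-)
proof (induction "card S" arbitrary: S k rule: less_induct)
  case less
  show ?case
  proof (cases "card S = 1")
    case True
    then obtain s where "S = {s}" by (auto simp: card_1_singleton_iff)
    then have "bij_betw (\<lambda>_. s) {k} S" by (auto simp: bij_betw_def)
    then show ?thesis using cotree_leaf[of k] by (metis atLeast_iff insertE empty_iff order_refl subsetI)
  next
    case False
    then have "2 \<le> card S" using less.prems by (metis One_nat_def Suc_leI card_0_eq le_neq_implies_less numeral_2_eq_2 not_gr_zero)
    then obtain S1 S2 c where sp: "splits S adj S1 S2 c"
      using p4free_splits[OF assms(1) less.prems(1) _ less.prems(3)] by blast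
    then have S: "S1 \<union> S2 = S" "S1 \<inter> S2 = {}" "S1 \<noteq> {}" "S2 \<noteq> {}"
      by (auto simp: splits_def)
    then have sub: "S1 \<subset> S" "S2 \<subset> S" by auto
    then have fin: "finite S1" "finite S2" and lt: "card S1 < card S" "card S2 < card S"
      and free: "p4free S1 adj" "p4free S2 adj"
      using less.prems by (auto intro: finite_subset psubset_card_mono p4free_subset)
    obtain V1 B1 r1 L1 t1 g1 where T1: "cotree V1 B1 r1 L1 t1 (\<lambda>x y. adj (g1 x) (g1 y))"
      "bij_betw g1 L1 S1" "V1 \<subseteq> {Suc k..}"
      using less.hyps[OF lt(1) fin(1) S(3) free(1)] by blast
    \<comment> \<open>Starting beyond \<open>k + Max V1\<close> makes the second vertex set disjoint
      from the first and keeps it off the new root.\<close>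
    obtain V2 B2 r2 L2 t2 g2 where T2: "cotree V2 B2 r2 L2 t2 (\<lambda>x y. adj (g2 x) (g2 y))"
      "bij_betw g2 L2 S2" "V2 \<subseteq> {Suc (k + Max V1)..}"
      using less.hyps[OF lt(2) fin(2) S(4) free(2)] by blast
    interpret T1: cotree V1 B1 r1 L1 t1 "\<lambda>x y. adj (g1 x) (g1 y)" by fact
    interpret T2: cotree V2 B2 r2 L2 t2 "\<lambda>x y. adj (g2 x) (g2 y)" by fact
    have "x \<le> Max V1" if "x \<in> V1" for x using that T1.fin by simp
    then have disj: "V1 \<inter> V2 = {}" using T2(3) by fastforce
    define g where "g x = (if x \<in> V1 then g1 x else g2 x)" for x
    define t where "t x = (if x = k then c else if x \<in> V1 then t1 x else t2 x)" for x
    have k: "k < v" if "v \<in> V1 \<union> V2" for v using that T1(3) T2(3) by auto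
    have g: "x \<in> L1 \<Longrightarrow> g x = g1 x" "x \<in> L2 \<Longrightarrow> g x = g2 x" for x
      using T1.leaf_subset T2.leaf_subset disj by (auto simp: g_def)
    interpret glued_cotrees V1 B1 r1 L1 V2 B2 r2 L2 t "\<lambda>x y. adj (g x) (g y)" k
    proof (intro glued_cotrees.intro glued_cotrees_axioms.intro)
      show "cotree V1 B1 r1 L1 t (\<lambda>x y. adj (g x) (g y))"
        by (rule cotree_cong[OF T1(1)]) (use g k in \<open>auto simp: t_def\<close>)
      show "cotree V2 B2 r2 L2 t (\<lambda>x y. adj (g x) (g y))"
        by (rule cotree_cong[OF T2(1)]) (use g k disj in \<open>auto simp: t_def\<close>)
      show "V1 \<inter> V2 = {}" by fact
      show "k < v" if "v \<in> V1 \<union> V2" for v using k[OF that] .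
      show "adj (g x) (g y) = t k \<and> adj (g y) (g x) = t k" if xy: "x \<in> L1" "y \<in> L2" for x y
      proof -
        have "g x \<in> S1" "g y \<in> S2" using xy g T1(2) T2(2) by (auto dest: bij_betwE)
        then show ?thesis
          using sp splits_commute[OF assms(1) sp] by (simp add: splits_def t_def)
      qed
    qed
    have "bij_betw g L1 S1" "bij_betw g L2 S2"
      using T1(2) T2(2) g by (simp_all cong: bij_betw_cong)
    then have "bij_betw g (L1 \<union> L2) S"
      using bij_betw_combine[of g L1 S1 L2 S2] S(1,2) by simp
    moreover have "V \<subseteq> {k..}" using k by (auto intro: less_imp_le)
    ultimately show ?thesis using glued_cotree by blast
  qed
qed

section \<open>From pseudo-cographs to networks\<close>

text \<open>The leaves s1 and s2 play the two copies of the cut vertex v: s1 becomes the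
  hybrid-vertex, with the parents of both copies as its parents, and s2 its only child.\<close>

locale hybridized = cotree V B r L t E
  for V B r L t E +
  fixes VL VR :: "nat set" and s1 s2 p q :: nat
  assumes parts: "V = insert r (VL \<union> VR)" "r \<notin> VL \<union> VR" "VL \<inter> VR = {}"
    and left: "s1 \<in> L" "s1 \<in> VL" "p \<in> VL" "(p, s1) \<in> B"
    and right: "s2 \<in> L" "s2 \<in> VR" "q \<in> VR" "(q, s2) \<in> B"
    and cross: "x \<in> VL \<Longrightarrow> y \<in> VR \<Longrightarrow> (w, x) \<in> B\<^sup>* \<Longrightarrow> (w, y) \<in> B\<^sup>* \<Longrightarrow> w = r"
begin

text \<open>Redirecting the arc of \<open>q\<close> keeps its outdegree, and the two copies of the
  cut vertex provide hybrid-vertex and leaf without any fresh vertex.\<close>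

definition arcs :: "(nat \<times> nat) set" where
  "arcs = (B - {(q, s2)}) \<union> {(q, s1), (s1, s2)}"

text \<open>\<open>s1\<close> has ceased to be a leaf and so must carry 0 or 1. Its only descendant
  besides itself is the leaf \<open>s2\<close>, so it is never the lca of two distinct leaves and
  either label would do.\<close>

definition lab :: "nat \<Rightarrow> label" where
  "lab n = (if n \<in> L - {s1} then LOdot else if t n then L1 else L0)"

lemma distinct_vertices: "s1 \<noteq> s2" "p \<noteq> q" "p \<noteq> s1" "p \<noteq> s2" "q \<noteq> s1" "q \<noteq> s2" "r \<noteq> s1" "r \<noteq> s2"
proof -
  have "p < s1" "q < s2" using incr left(4) right(4) by blast+
  moreover have "a \<noteq> b" if "a \<in> VL" "b \<in> VR" for a b using that parts(3) by blast
  moreover have "a \<noteq> r" if "a \<in> VL \<union> VR" for a using that parts(2) by blast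
  ultimately show "s1 \<noteq> s2" "p \<noteq> q" "p \<noteq> s1" "p \<noteq> s2" "q \<noteq> s1" "q \<noteq> s2" "r \<noteq> s1" "r \<noteq> s2"
    using left(2,3) right(2,3) by auto
qed

lemma leaf_no_child: "x \<in> L \<Longrightarrow> (x, c) \<notin> B"
  using leaf by blast

lemma arcs_iff:
  "(a, v) \<in> arcs \<longleftrightarrow> (if v = s1 then a = p \<or> a = q else if v = s2 then a = s1 else (a, v) \<in> B)"
  using left(4) right(4) uniq distinct_vertices by (auto simp: arcs_def)

lemma arcs_subset: "arcs \<subseteq> V \<times> V"
  using sub parts left right by (auto simp: arcs_def)

text \<open>All arcs that differ end in \<open>s1\<close> or \<open>s2\<close>. These were leaves of
  the tree, so no path to another vertex passes through them.\<close>

lemma path_arcs_iff: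
  assumes "y \<noteq> s1" "y \<noteq> s2"
  shows "(w, y) \<in> arcs\<^sup>* \<longleftrightarrow> (w, y) \<in> B\<^sup>*"
proof
  show "(w, y) \<in> B\<^sup>*" if "(w, y) \<in> arcs\<^sup>*"
    using that assms
  proof (induction rule: rtrancl_induct)
    case (step y z)
    then have yz: "(y, z) \<in> B" using arcs_iff by simp
    then have "y \<noteq> s1" "y \<noteq> s2" using leaf_no_child left(1) right(1) by blast+
    then show ?case using step.IH yz by (meson rtrancl.rtrancl_into_rtrancl)
  qed simp
  show "(w, y) \<in> arcs\<^sup>*" if "(w, y) \<in> B\<^sup>*"
    using that assms
  proof (induction rule: rtrancl_induct)
    case (step y z)
    then have yz: "(y, z) \<in> arcs" using arcs_iff by simp
    have "y \<noteq> s1" "y \<noteq> s2" using step.hyps(2) leaf_no_child left(1) right(1) by blast+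
    then show ?case using step.IH yz by (meson rtrancl.rtrancl_into_rtrancl)
  qed simp
qed

lemma path_to_s1: "(w, s1) \<in> arcs\<^sup>* \<longleftrightarrow> w = s1 \<or> (w, p) \<in> B\<^sup>* \<or> (w, q) \<in> B\<^sup>*"
proof -
  have "(w, s1) \<in> arcs\<^sup>* \<longleftrightarrow> w = s1 \<or> (w, p) \<in> arcs\<^sup>* \<or> (w, q) \<in> arcs\<^sup>*"
    using arcs_iff[of _ s1] by (auto elim: rtranclE intro: rtrancl.rtrancl_into_rtrancl)
  then show ?thesis using path_arcs_iff distinct_vertices by simp
qed

lemma path_to_s2: "(w, s2) \<in> arcs\<^sup>* \<longleftrightarrow> w = s2 \<or> w = s1 \<or> (w, p) \<in> B\<^sup>* \<or> (w, q) \<in> B\<^sup>*"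
proof -
  have "(w, s2) \<in> arcs\<^sup>* \<longleftrightarrow> w = s2 \<or> (w, s1) \<in> arcs\<^sup>*"
    using arcs_iff[of _ s2] distinct_vertices
    by (auto elim: rtranclE intro: rtrancl.rtrancl_into_rtrancl)
  then show ?thesis using path_to_s1 by simp
qed

lemma acyclic_arcs: "acyclic arcs"
proof -
  \<comment> \<open>The given numbers need not increase along the new arcs. Lifting
    \<open>s1\<close> above all of \<open>V\<close>, and \<open>s2\<close> above \<open>s1\<close>,
    restores a topological numbering.\<close>
  define M where "M = Suc (Max V)"
  define f where "f n = (if n = s1 then M else if n = s2 then Suc M else n)" for n
  have M: "n < M" if "n \<in> V" for n
    using that fin by (simp add: M_def le_imp_less_Suc)
  have "f a < f b" if "(a, b) \<in> arcs" for a b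
  proof -
    have ab: "a \<in> V" "b \<in> V" using that arcs_subset by blast+
    show ?thesis
    proof (cases "b = s1 \<or> b = s2")
      case True
      then show ?thesis
        using that arcs_iff[of a b] distinct_vertices M[OF ab(1)] by (auto simp: f_def)
    next
      case False
      then have "(a, b) \<in> B" using that arcs_iff by simp
      then have "a \<noteq> s1" "a \<noteq> s2" "a < b" using leaf_no_child left(1) right(1) incr by blast+
      then show ?thesis using False by (simp add: f_def)
    qed
  qed
  note f = this
  have "f a < f b" if "(a, b) \<in> arcs\<^sup>+" for a b
    using that by (induction rule: trancl_induct) (auto dest: f)
  then show ?thesis unfolding acyclic_def by blast
qed

lemma reach_arcs: "v \<in> V \<Longrightarrow> (r, v) \<in> arcs\<^sup>*"
  using path_arcs_iff[of v r] path_to_s1[of r] path_to_s2[of r] reach[of v] reach[of p] parts(1) left(3)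
  by (cases "v = s1 \<or> v = s2") auto

sublocale N: one_hybrid V arcs r s1 p q
proof
  show "a = b" if "(a, v) \<in> arcs" "(b, v) \<in> arcs" "v \<noteq> s1" for a b v
    using that arcs_iff[of a v] arcs_iff[of b v] uniq by (auto split: if_splits)
  show "(a, s1) \<in> arcs \<longleftrightarrow> a = p \<or> a = q" for a using arcs_iff by simp
qed (use fin arcs_subset acyclic_arcs reach_arcs distinct_vertices in auto)

lemma parents_simps:
  "{u. (u, s1) \<in> arcs} = {p, q}" "{u. (u, s2) \<in> arcs} = {s1}" "{u. (u, r) \<in> arcs} = {}"
  using arcs_iff distinct_vertices root_no_parent by auto

lemma indeg_s1: "indeg arcs s1 = 2"
  unfolding indeg_def parents_simps using distinct_vertices by simp

lemma indeg_root: "indeg arcs r = 0"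
  unfolding indeg_def parents_simps by simp

lemma indeg_other:
  assumes "v \<in> V" "v \<noteq> s1" "v \<noteq> r"
  shows "indeg arcs v = 1"
proof (cases "v = s2")
  case True
  then show ?thesis unfolding indeg_def using parents_simps by simp
next
  case False
  obtain u where u: "(u, v) \<in> B" using ex_parent assms by blast
  then have "{u. (u, v) \<in> arcs} = {u}" using uniq arcs_iff[of _ v] assms False by auto
  then show ?thesis unfolding indeg_def by simp
qed

lemma hybrid_iff: "hybrid V arcs v \<longleftrightarrow> v = s1"
  unfolding hybrid_def using indeg_s1 indeg_root indeg_other[of v] N.in_V(3)
  by (cases "v = r"; cases "v = s1") auto

lemma outdeg_leaf:
  assumes "x \<in> L - {s1}"
  shows "outdeg arcs x = 0"
proof -
  have "(x, c) \<notin> arcs" for c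
    using assms arcs_iff[of x c] leaf_no_child left(4) right(4) by (auto split: if_splits)
  then show ?thesis by (simp add: outdeg_def)
qed

lemma child_s1: "(s1, c) \<in> arcs \<longleftrightarrow> c = s2"
  using arcs_iff[of s1 c] leaf_no_child left(1) distinct_vertices by auto

lemma outdeg_s1: "outdeg arcs s1 = 1"
  unfolding outdeg_def child_s1 by simp

lemma outdeg_inner:
  assumes "v \<in> V" "v \<notin> L"
  shows "2 \<le> outdeg arcs v"
proof -
  obtain c d where cd: "c \<noteq> d" "(v, c) \<in> B" "(v, d) \<in> B" using inner assms by blast
  \<comment> \<open>Tree children become network children when \<open>s2\<close> is replaced by
    \<open>s1\<close>. No vertex has both as children, since \<open>p\<close> and \<open>q\<close>
    differ, so distinct children stay distinct.\<close>
  define f where "f n = (if n = s2 then s1 else n)" for n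
  have arc: "(v, f x) \<in> arcs" if "(v, x) \<in> B" for x
    using that arcs_iff[of v "f x"] uniq left(4) right(4) by (auto simp: f_def)
  have "(v, s1) \<notin> B \<or> (v, s2) \<notin> B"
    using uniq left(4) right(4) distinct_vertices(2) by metis
  then have "f c \<noteq> f d"
    using cd by (auto simp: f_def split: if_splits)
  moreover have "finite {w. (v, w) \<in> arcs}"
    by (rule finite_subset[OF _ fin]) (use arcs_subset in auto)
  then have "card {f c, f d} \<le> card {w. (v, w) \<in> arcs}"
    using arc cd by (intro card_mono) auto
  ultimately show ?thesis by (simp add: outdeg_def)
qed

lemma root_inner: "r \<notin> L"
proof
  assume "r \<in> L"
  then have "(r, s1) \<notin> B\<^sup>*" using leaf_no_child distinct_vertices(7) by (metis converse_rtranclE)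
  then show False using reach left leaf_subset by blast
qed

lemma net_root_arcs: "net_root V arcs = r"
  and ex1_root: "\<exists>!x. x \<in> V \<and> indeg arcs x = 0"
proof -
  have *: "x = r" if "x \<in> V" "indeg arcs x = 0" for x
    using that indeg_s1 indeg_other[of x] by (metis zero_neq_numeral zero_neq_one)
  then show "\<exists>!x. x \<in> V \<and> indeg arcs x = 0" using root indeg_root by blast
  show "net_root V arcs = r"
    unfolding net_root_def by (rule the_equality) (use root indeg_root * in blast)+
qed

lemma network: "is_network V arcs (L - {s1})"
proof -
  have "x \<in> L - {s1} \<longleftrightarrow> outdeg arcs x = 0 \<and> indeg arcs x = 1" if x: "x \<in> V" for x
  proof (cases "x \<in> L - {s1}")
    case True
    then have "x \<noteq> r" using root_inner by blast
    then show ?thesis using True outdeg_leaf indeg_other x by simp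
  next
    case False
    then show ?thesis using outdeg_inner[OF x] outdeg_s1 by (cases "x = s1") auto
  qed
  moreover have "(indeg arcs v = 1 \<and> outdeg arcs v \<ge> 2) \<or> (indeg arcs v = 2 \<and> outdeg arcs v \<ge> 1)"
    if "v \<in> V" "v \<noteq> r" "v \<notin> L - {s1}" for v
    using that indeg_s1 outdeg_s1 indeg_other[of v] outdeg_inner[of v] by (cases "v = s1") auto
  ultimately show ?thesis
    unfolding is_network_def net_root_arcs
    using fin arcs_subset acyclic_arcs leaf_subset ex1_root outdeg_inner[OF root root_inner] by auto
qed

lemma level1_arcs: "level1 V arcs"
  unfolding level1_def
proof (intro allI impI)
  fix W
  have "card {h \<in> W. hybrid V arcs h} \<le> card {s1}" by (intro card_mono) (auto simp: hybrid_iff)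
  then show "card {h \<in> W. hybrid V arcs h} \<le> 1" by simp
qed

lemma labeling: "is_labeling V (L - {s1}) lab"
  unfolding is_labeling_def lab_def by simp

lemma cycle:
  "\<exists>C. {C'. is_cycle V arcs C'} = {C} \<and> cycle_root arcs C = net_root V arcs \<and>
    (\<exists>!c. (cycle_hybrid V arcs C, c) \<in> arcs) \<and>
    (\<forall>c. (cycle_hybrid V arcs C, c) \<in> arcs \<longrightarrow> c \<in> L - {s1})"
proof (intro exI conjI)
  let ?C = "cycle_set arcs r p q s1"
  have rpq: "(r, p) \<in> arcs\<^sup>*" "(r, q) \<in> arcs\<^sup>*"
    using reach_arcs N.in_V by blast+
  have low: "(u, r) \<in> arcs\<^sup>*" if "(u, p) \<in> arcs\<^sup>*" "(u, q) \<in> arcs\<^sup>*" for u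
    using that path_arcs_iff distinct_vertices cross[OF left(3) right(3), of u] by simp
  show "{C'. is_cycle V arcs C'} = {?C}" by (rule N.cycles_eq[OF rpq low])
  show "cycle_root arcs ?C = net_root V arcs"
    unfolding net_root_arcs by (rule N.cycle_root_W[OF rpq low])
  have "cycle_hybrid V arcs ?C = s1"
    unfolding cycle_hybrid_def hybrid_iff by (rule the_equality) (auto simp: cycle_set_def)
  then show "\<exists>!c. (cycle_hybrid V arcs ?C, c) \<in> arcs"
    "\<forall>c. (cycle_hybrid V arcs ?C, c) \<in> arcs \<longrightarrow> c \<in> L - {s1}"
    using child_s1 right(1) distinct_vertices(1) by auto
qed

lemma lab_lcaI:
  assumes "x \<in> L" "y \<in> L" "x \<noteq> y" and m: "(m, x) \<in> B\<^sup>*" "(m, y) \<in> B\<^sup>*"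
  shows "lab m = L1 \<longleftrightarrow> t m"
proof -
  have "m \<notin> L"
  proof
    assume "m \<in> L"
    then have "m = x" "m = y" using m leaf_no_child by (metis converse_rtranclE)+
    then show False using assms(3) by simp
  qed
  then show ?thesis by (simp add: lab_def)
qed

lemma leaf_sides: "x \<in> L \<Longrightarrow> x \<in> VL \<or> x \<in> VR"
  using leaf_subset root_inner parts(1) by blast

lemma lca_in_V:
  assumes "(m, x) \<in> B\<^sup>*" "x \<in> L" shows "m \<in> V"
  using assms leaf_subset sub by (blast elim: converse_rtranclE)

lemma lab_lca_other:
  assumes x: "x \<in> L - {s1, s2}" and y: "y \<in> L - {s1, s2}" and "x \<noteq> y"
  shows "lab (lca V arcs x y) = L1 \<longleftrightarrow> E x y"
proof -
  have L: "x \<in> L" "y \<in> L" using x y by auto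
  obtain m where m: "(m, x) \<in> B\<^sup>*" "(m, y) \<in> B\<^sup>*"
    "\<And>w. (w, x) \<in> B\<^sup>* \<Longrightarrow> (w, y) \<in> B\<^sup>* \<Longrightarrow> (w, m) \<in> B\<^sup>*" "t m \<longleftrightarrow> E x y"
    using lca[OF L \<open>x \<noteq> y\<close>] by blast
  have ms: "m \<noteq> s1" "m \<noteq> s2"
    using m(1) x leaf_no_child left(1) right(1) by (metis DiffE converse_rtranclE insertCI)+
  have "lca V arcs x y = m"
    using path_arcs_iff ms m x y lca_in_V[OF m(1) L(1)] by (intro lca_eqI[OF acyclic_arcs]) auto
  then show ?thesis using lab_lcaI[OF L \<open>x \<noteq> y\<close> m(1,2)] m(4) by simp
qed

text \<open>The leaf \<open>s2\<close> gains the ancestors of both copies, but those from the side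
  opposite to \<open>x\<close> share only the root with \<open>x\<close>. So the lca is the one that
  \<open>x\<close> and the copy on its own side have in the tree.\<close>

lemma lab_lca_s2:
  assumes x: "x \<in> L - {s1, s2}"
  shows "lab (lca V arcs x s2) = L1 \<longleftrightarrow> E x (if x \<in> VL then s1 else s2)"
proof -
  define s where "s = (if x \<in> VL then s1 else s2)"
  have L: "x \<in> L" "s \<in> L" "x \<noteq> s" using x left(1) right(1) by (auto simp: s_def)
  obtain m where m: "(m, x) \<in> B\<^sup>*" "(m, s) \<in> B\<^sup>*"
    "\<And>w. (w, x) \<in> B\<^sup>* \<Longrightarrow> (w, s) \<in> B\<^sup>* \<Longrightarrow> (w, m) \<in> B\<^sup>*" "t m \<longleftrightarrow> E x s"
    using lca[OF L] by blast
  have ns: "w \<noteq> s1 \<and> w \<noteq> s2" if "(w, x) \<in> B\<^sup>*" for w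
    using that x leaf_no_child left(1) right(1) by (metis DiffE converse_rtranclE insertCI)
  have above: "(w, s) \<in> B\<^sup>* \<longleftrightarrow> (w, if x \<in> VL then p else q) \<in> B\<^sup>*" if "w \<noteq> s1" "w \<noteq> s2" for w
  proof
    assume "(w, s) \<in> B\<^sup>*"
    then obtain z where "(w, z) \<in> B\<^sup>*" "(z, s) \<in> B"
      using \<open>w \<noteq> s1\<close> \<open>w \<noteq> s2\<close> by (metis rtranclE s_def)
    then show "(w, if x \<in> VL then p else q) \<in> B\<^sup>*"
      using uniq left(4) right(4) by (metis s_def)
  next
    assume "(w, if x \<in> VL then p else q) \<in> B\<^sup>*"
    then show "(w, s) \<in> B\<^sup>*"
      using left(4) right(4) by (auto simp: s_def split: if_splits intro: rtrancl.rtrancl_into_rtrancl)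
  qed
  have rm: "(r, m) \<in> B\<^sup>*" using lca_in_V[OF m(1) L(1)] reach by blast
  have "lca V arcs x s2 = m"
  proof (rule lca_eqI[OF acyclic_arcs])
    show "m \<in> V" using lca_in_V[OF m(1) L(1)] .
    show "(m, x) \<in> arcs\<^sup>*" using m(1) path_arcs_iff x by simp
    show "(m, s2) \<in> arcs\<^sup>*"
      using above[of m] ns[OF m(1)] m(2) path_to_s2 by (auto split: if_splits)
    fix w assume w: "(w, x) \<in> arcs\<^sup>*" "(w, s2) \<in> arcs\<^sup>*"
    then have wx: "(w, x) \<in> B\<^sup>*" using path_arcs_iff x by simp
    then have "(w, p) \<in> B\<^sup>* \<or> (w, q) \<in> B\<^sup>*" using ns w(2) path_to_s2 by blast
    then have "w = r \<or> (w, if x \<in> VL then p else q) \<in> B\<^sup>*"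
      using cross[of x q w] cross[of p x w] wx leaf_sides[OF L(1)] left(3) right(3) by auto
    then have "(w, m) \<in> B\<^sup>*" using above[of w] ns[OF wx] m(3)[OF wx] rm by blast
    then show "(w, m) \<in> arcs\<^sup>*" using path_arcs_iff ns[OF m(1)] by simp
  qed
  then show ?thesis using lab_lcaI[OF L m(1,2)] m(4) by (simp add: s_def)
qed

end

lemma lca_commute: "lca V A x y = lca V A y x"
  unfolding lca_def by (simp add: conj_ac)

lemma glued_network:
  assumes G: "is_graph G" "fst G = V1 \<union> V2" "V1 \<inter> V2 = {v}" "1 < card V1" "1 < card V2"
    and free: "p4free V1 (\<lambda>x y. (x, y) \<in> snd G)" "p4free V2 (\<lambda>x y. (x, y) \<in> snd G)"
    and cross_adj: "\<forall>x\<in>V1 - {v}. \<forall>y\<in>V2 - {v}. (x, y) \<in> snd G \<longleftrightarrow> c"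
  shows "\<exists>V A X t. is_network V A X \<and> level1 V A \<and> is_labeling V X t \<and> explains V A X t G \<and>
       (\<exists>C. {C'. is_cycle V A C'} = {C} \<and>
            cycle_root A C = net_root V A \<and>
            (\<exists>!c. (cycle_hybrid V A C, c) \<in> A) \<and>
            (\<forall>c. (cycle_hybrid V A C, c) \<in> A \<longrightarrow> c \<in> X))"
proof -
  define adj where "adj = (\<lambda>x y. (x, y) \<in> snd G)"
  have sym: "symp adj"
    using G(1) by (auto simp: adj_def is_graph_def sym_def symp_def)
  then have adj_sym: "adj x y = adj y x" for x y by (auto dest: sympD)
  have fin: "finite V1" "finite V2" using G(4,5) card.infinite by fastforce+
  have free': "p4free V1 adj" "p4free V2 adj" using free by (simp_all add: adj_def)
  have ne: "V1 \<noteq> {}" "V2 \<noteq> {}" using G(4,5) by auto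
  \<comment> \<open>Numbering from 1 keeps \<open>0\<close> free for the common root.\<close>
  obtain VL BL rL LL tL gL where TL: "cotree VL BL rL LL tL (\<lambda>x y. adj (gL x) (gL y))"
    "bij_betw gL LL V1" "VL \<subseteq> {1..}"
    using ex_cotree[OF sym fin(1) ne(1) free'(1)] by blast
  obtain VR BR rR LR tR gR where TR: "cotree VR BR rR LR tR (\<lambda>x y. adj (gR x) (gR y))"
    "bij_betw gR LR V2" "VR \<subseteq> {Suc (Max VL)..}"
    using ex_cotree[OF sym fin(2) ne(2) free'(2)] by blast
  interpret TL: cotree VL BL rL LL tL "\<lambda>x y. adj (gL x) (gL y)" by fact
  interpret TR: cotree VR BR rR LR tR "\<lambda>x y. adj (gR x) (gR y)" by fact
  have "x \<le> Max VL" if "x \<in> VL" for x using that TL.fin by simp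
  then have disj: "VL \<inter> VR = {}" using TR(3) by fastforce
  have pos: "0 < x" if "x \<in> VL \<union> VR" for x using that TL(3) TR(3) by auto
  define g where "g x = (if x \<in> VL then gL x else gR x)" for x
  define t where "t x = (if x = 0 then c else if x \<in> VL then tL x else tR x)" for x
  \<comment> \<open>Across the sides \<open>E\<close> is constant even for the copies of
    \<open>v\<close>, whose true adjacency to the opposite part may differ from \<open>c\<close>.
    This does no harm: adjacency to \<open>v\<close> is only ever read from the copy on the same
    side.\<close>
  define E where "E x y = (if x \<in> VL \<longleftrightarrow> y \<in> VL then adj (g x) (g y) else c)" for x y
  have side: "x \<in> LL \<Longrightarrow> x \<in> VL" "x \<in> LR \<Longrightarrow> x \<in> VR" "x \<in> VR \<Longrightarrow> x \<notin> VL" for x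
    using TL.leaf_subset TR.leaf_subset disj by blast+
  have gv: "x \<in> LL \<Longrightarrow> g x = gL x" "x \<in> LR \<Longrightarrow> g x = gR x" for x
    using side by (simp_all add: g_def)
  interpret glued_cotrees VL BL rL LL VR BR rR LR t E 0
  proof (intro glued_cotrees.intro glued_cotrees_axioms.intro)
    show "cotree VL BL rL LL t E"
    proof (rule cotree_cong[OF TL(1)])
      show "adj (gL x) (gL y) = E x y" if "x \<in> LL" "y \<in> LL" for x y
        using that side by (simp add: E_def gv)
      show "tL x = t x" if "x \<in> VL" for x using that pos[of x] by (simp add: t_def)
    qed
    show "cotree VR BR rR LR t E"
    proof (rule cotree_cong[OF TR(1)])
      show "adj (gR x) (gR y) = E x y" if "x \<in> LR" "y \<in> LR" for x y
        using that side by (simp add: E_def gv)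
      show "tR x = t x" if "x \<in> VR" for x using that pos[of x] side(3) by (simp add: t_def)
    qed
    show "VL \<inter> VR = {}" by fact
    show "0 < x" if "x \<in> VL \<union> VR" for x using pos[OF that] .
    show "E x y = t 0 \<and> E y x = t 0" if "x \<in> LL" "y \<in> LR" for x y
      using that side by (simp add: E_def t_def)
  qed
  have bij: "bij_betw g LL V1" "bij_betw g LR V2"
    using TL(2) TR(2) gv by (simp_all cong: bij_betw_cong)
  have "v \<in> V1" "v \<in> V2" using G(3) by auto
  then obtain s1 s2 where s: "s1 \<in> LL" "g s1 = v" "s2 \<in> LR" "g s2 = v"
    using bij by (metis bij_betw_iff_bijections)
  \<comment> \<open>Each part has at least two vertices, so its copy of \<open>v\<close> is not the
    root of its cotree. Thus both parents of the hybrid-vertex lie inside the two sides and neither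
    of them is \<open>0\<close>.\<close>
  have nonroot: "s \<noteq> r" if "cotree V B r L t E" "s \<in> L" "1 < card L" for V B r L t E s
  proof
    interpret cotree V B r L t E by fact
    assume "s = r"
    have "\<not> L \<subseteq> {s}"
    proof
      assume "L \<subseteq> {s}"
      then have "card L \<le> 1" using card_mono[of "{s}" L] by simp
      then show False using that(3) by simp
    qed
    then obtain y where "y \<in> L" "y \<noteq> s" by blast
    then have "(s, y) \<in> B\<^sup>*" using reach leaf_subset \<open>s = r\<close> by blast
    then show False using \<open>y \<noteq> s\<close> leaf that(2) by (metis converse_rtranclE)
  qed
  have "card LL = card V1" "card LR = card V2" using bij by (auto dest: bij_betw_same_card)
  then have "s1 \<noteq> rL" "s2 \<noteq> rR" using nonroot[OF TL(1)] nonroot[OF TR(1)] s G(4,5) by auto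
  then obtain p q where pq: "(p, s1) \<in> BL" "(q, s2) \<in> BR"
    using TL.ex_parent TR.ex_parent side s by metis
  interpret hybridized V B 0 "LL \<union> LR" t E VL VR s1 s2 p q
  proof (intro hybridized.intro hybridized_axioms.intro)
    show "cotree V B 0 (LL \<union> LR) t E" by (rule glued_cotree)
    show "w = 0" if "x \<in> VL" "y \<in> VR" "(w, x) \<in> B\<^sup>*" "(w, y) \<in> B\<^sup>*" for w x y
      using cross_ancestor[OF that] .
    show "0 \<notin> VL \<union> VR" using k_notin by blast
  qed (use s pq side TL.sub TR.sub disj pos in auto)
  let ?X = "LL \<union> LR - {s1}"
  have X_eq: "?X = (LL - {s1}) \<union> LR" using s side by auto
  have "bij_betw g (LL - {s1}) (V1 - {v})"
    using bij_betw_DiffI[OF bij(1), of "{s1}" "{v}"] s \<open>v \<in> V1\<close> by (simp add: bij_betw_def)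
  moreover have "(V1 - {v}) \<inter> V2 = {}" "(V1 - {v}) \<union> V2 = fst G" using G(2,3) by auto
  ultimately have gX: "bij_betw g ?X (fst G)"
    using bij_betw_combine[of g "LL - {s1}" "V1 - {v}" LR V2] bij(2) X_eq by simp
  have gL: "g x \<in> V1 - {v}" if "x \<in> LL" "x \<noteq> s1" for x
    using that s bij_betwE[OF bij(1)] inj_onD[OF bij_betw_imp_inj_on[OF bij(1)], of x s1]
    by auto
  have gR: "g x \<in> V2 - {v}" if "x \<in> LR" "x \<noteq> s2" for x
    using that s bij_betwE[OF bij(2)] inj_onD[OF bij_betw_imp_inj_on[OF bij(2)], of x s2]
    by auto
  have crossadj: "adj (g x) (g y) \<longleftrightarrow> c" if "x \<in> LL" "x \<noteq> s1" "y \<in> LR" "y \<noteq> s2" for x y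
    using cross_adj gL[OF that(1,2)] gR[OF that(3,4)] by (simp add: adj_def)
  have E_adj: "E x y = adj (g x) (g y)" if "x \<in> ?X - {s2}" "y \<in> ?X - {s2}" for x y
    using that crossadj[of x y] crossadj[of y x] side adj_sym[of "g x" "g y"]
    unfolding E_def by auto
  have s2_adj: "lab (lca V arcs x s2) = L1 \<longleftrightarrow> adj (g x) (g s2)" if "x \<in> ?X - {s2}" for x
    using lab_lca_s2[of x] that s side by (auto simp: E_def)
  have lca_adj: "lab (lca V arcs x y) = L1 \<longleftrightarrow> adj (g x) (g y)"
    if "x \<in> ?X" "y \<in> ?X" "x \<noteq> y" for x y
  proof -
    consider "x = s2" "y \<noteq> s2" | "x \<noteq> s2" "y = s2" | "x \<noteq> s2" "y \<noteq> s2" using \<open>x \<noteq> y\<close> by blast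
    then show ?thesis
    proof cases
      case 1
      then show ?thesis using s2_adj[of y] that lca_commute[of V arcs x y] adj_sym[of "g x"] by simp
    next
      case 2
      then show ?thesis using s2_adj[of x] that by simp
    next
      case 3
      then show ?thesis using lab_lca_other[of x y] E_adj[of x y] that by simp
    qed
  qed
  have expl: "explains V arcs ?X lab G"
    unfolding explains_def
  proof (intro exI conjI ballI impI)
    let ?f = "inv_into ?X g"
    show bij_f: "bij_betw ?f (fst G) ?X" by (rule bij_betw_inv_into[OF gX])
    fix a b assume ab: "a \<in> fst G" "b \<in> fst G" "a \<noteq> b"
    have fX: "?f a \<in> ?X" "?f b \<in> ?X" using bij_betwE[OF bij_f] ab by blast+
    have gf: "g (?f a) = a" "g (?f b) = b" using bij_betw_inv_into_right[OF gX] ab by auto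
    then have "?f a \<noteq> ?f b" using ab(3) by metis
    from lca_adj[OF fX this] have "lab (lca V arcs (?f a) (?f b)) = L1 \<longleftrightarrow> adj a b"
      unfolding gf .
    then show "(a, b) \<in> snd G \<longleftrightarrow> lab (lca V arcs (?f a) (?f b)) = L1" by (simp add: adj_def)
  qed
  show ?thesis
    by (rule exI[of _ V], rule exI[of _ arcs], rule exI[of _ ?X], rule exI[of _ lab])
      (intro conjI network level1_arcs labeling expl cycle)
qed

section \<open>From networks to pseudo-cographs\<close>

text \<open>Requiring \<open>card X\<close> to differ from 1 discards the single-vertex alternative
  of \<open>is_network\<close>; a graph on one vertex is a pseudo-cograph outright.\<close>

locale rooted_network =
  fixes V :: "nat set" and A :: "(nat \<times> nat) set" and X :: "nat set"
  assumes net: "is_network V A X" and nontrivial: "card X \<noteq> 1"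
begin

abbreviation "root \<equiv> net_root V A"

lemma basic: "finite V" "A \<subseteq> V \<times> V" "acyclic A" "X \<subseteq> V"
  using net by (auto simp: is_network_def)

lemma degrees:
  shows "\<exists>!r. r \<in> V \<and> indeg A r = 0" "2 \<le> outdeg A root"
    "x \<in> V \<Longrightarrow> x \<in> X \<longleftrightarrow> outdeg A x = 0 \<and> indeg A x = 1"
    "v \<in> V \<Longrightarrow> v \<noteq> root \<Longrightarrow> v \<notin> X \<Longrightarrow>
      indeg A v = 1 \<and> 2 \<le> outdeg A v \<or> indeg A v = 2 \<and> 1 \<le> outdeg A v"
  using net nontrivial unfolding is_network_def by blast+

lemma finite_neighbours: "finite {u. (u, v) \<in> A}" "finite {w. (v, w) \<in> A}"
  using basic(2) by (auto intro: finite_subset[OF _ basic(1)])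

lemma root_props: "root \<in> V" "indeg A root = 0"
  using theI'[OF degrees(1)] unfolding net_root_def by auto

lemma root_only: "v \<in> V \<Longrightarrow> indeg A v = 0 \<Longrightarrow> v = root"
  using degrees(1) root_props by blast

lemma finite_arcs: "finite A"
  using basic by (meson finite_SigmaI finite_subset)

lemma root_reaches: "v \<in> V \<Longrightarrow> (root, v) \<in> A\<^sup>*"
proof (induction v rule: wf_induct_rule[OF finite_acyclic_wf[OF finite_arcs basic(3)]])
  case (1 v)
  show ?case
  proof (cases "v = root")
    case False
    then have "card {u. (u, v) \<in> A} \<noteq> 0" using root_only 1(2) by (auto simp: indeg_def)
    then obtain u where u: "(u, v) \<in> A" by fastforce
    then have "(root, u) \<in> A\<^sup>*" using 1(1) basic(2) by blast
    then show ?thesis using u by (meson rtrancl.rtrancl_into_rtrancl)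
  qed simp
qed

lemma leaf_no_child: "x \<in> X \<Longrightarrow> (x, c) \<notin> A"
  using degrees(3)[of x] basic(4) finite_neighbours(2)[of x] by (auto simp: outdeg_def)

lemma leaf_path: "x \<in> X \<Longrightarrow> (x, y) \<in> A\<^sup>* \<longleftrightarrow> y = x"
  using leaf_no_child by (metis converse_rtranclE rtrancl.rtrancl_refl)

lemma leaf_below: "v \<in> V \<Longrightarrow> \<exists>x\<in>X. (v, x) \<in> A\<^sup>*"
proof (induction v rule: wf_induct_rule[OF finite_acyclic_wf_converse[OF finite_arcs basic(3)]])
  case (1 v)
  show ?case
  proof (cases "v \<in> X")
    case False
    then have "1 \<le> outdeg A v"
      using degrees(2) degrees(4)[of v] 1(2) by (cases "v = root") auto
    then obtain c where c: "(v, c) \<in> A" by (fastforce simp: outdeg_def)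
    then obtain x where "x \<in> X" "(c, x) \<in> A\<^sup>*" using 1(1)[of c] basic(2) by auto
    then show ?thesis using c by (meson converse_rtrancl_into_rtrancl)
  qed blast
qed

lemma indeg_le_2: "v \<in> V \<Longrightarrow> indeg A v = 0 \<or> indeg A v = 1 \<or> indeg A v = 2"
  using degrees(3)[of v] degrees(4)[of v] root_props by (cases "v = root"; cases "v \<in> X") auto

lemma unique_parent:
  assumes "(a, v) \<in> A" "(b, v) \<in> A" "\<not> hybrid V A v"
  shows "a = b"
proof -
  have "v \<in> V" using assms(1) basic(2) by blast
  moreover have "card {u. (u, v) \<in> A} \<noteq> 0" using assms(1) finite_neighbours(1)[of v] by auto
  ultimately have "card {u. (u, v) \<in> A} = 1"
    using indeg_le_2[OF \<open>v \<in> V\<close>] assms(3) by (auto simp: hybrid_def indeg_def)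
  then obtain u where "{u. (u, v) \<in> A} = {u}" by (auto simp: card_1_singleton_iff)
  then show ?thesis using assms(1,2) by (metis mem_Collect_eq singletonD)
qed

lemma hybrid_parents:
  assumes "hybrid V A h"
  obtains p q where "p \<noteq> q" "\<And>a. (a, h) \<in> A \<longleftrightarrow> a = p \<or> a = q"
proof -
  have "card {u. (u, h) \<in> A} = 2" using assms by (simp add: hybrid_def indeg_def)
  then obtain p q where "{u. (u, h) \<in> A} = {p, q}" "p \<noteq> q" by (auto simp: card_2_iff)
  then show ?thesis using that by blast
qed

text \<open>Together with level-1 this leaves just one hybrid-vertex when there is only one cycle.
  Before that is known, parents need not be unique above \<open>p\<close> and \<open>q\<close>, so
  \<open>w\<close> is merely some minimal common ancestor. That suffices for a biconnected set
  around \<open>h\<close>, and a maximal biconnected superset is the cycle.\<close>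

lemma hybrid_in_cycle:
  assumes h: "hybrid V A h"
  shows "\<exists>C. is_cycle V A C \<and> h \<in> C"
proof -
  obtain p q where pq: "p \<noteq> q" "\<And>a. (a, h) \<in> A \<longleftrightarrow> a = p \<or> a = q"
    using hybrid_parents[OF h] by blast
  have pqV: "p \<in> V" "q \<in> V" using pq basic(2) by blast+
  let ?Q = "{u. (u, p) \<in> A\<^sup>* \<and> (u, q) \<in> A\<^sup>*}"
  have "wf ((A\<^sup>+)\<inverse>)"
    using finite_acyclic_wf_converse[OF finite_arcs basic(3)] by (metis trancl_converse wf_trancl)
  moreover have "root \<in> ?Q" using root_reaches pqV by blast
  ultimately have "\<exists>w\<in>?Q. \<forall>u. (u, w) \<in> (A\<^sup>+)\<inverse> \<longrightarrow> u \<notin> ?Q"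
    unfolding wf_eq_minimal by meson
  then obtain w where w: "(w, p) \<in> A\<^sup>*" "(w, q) \<in> A\<^sup>*"
    and min: "\<And>u. (w, u) \<in> A\<^sup>+ \<Longrightarrow> u \<notin> ?Q"
    by auto
  let ?W = "cycle_set A w p q h"
  have par: "(p, h) \<in> A" "(q, h) \<in> A" using pq by blast+
  have bic: "biconnected_on A ?W"
  proof (rule biconnected_cycle_set[OF basic(3) par w])
    fix y assume y: "(w, y) \<in> A\<^sup>*" "(y, p) \<in> A\<^sup>*" "(y, q) \<in> A\<^sup>*"
    then have "(w, y) \<notin> A\<^sup>+" using min by blast
    then show "y = w" using y(1) by (metis rtranclD)
  qed
  have "u \<in> V" if "(u, z) \<in> A\<^sup>*" "z \<in> V" for u z
    using that basic(2) by (blast elim: converse_rtranclE)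
  then have WV: "?W \<subseteq> V" using h pqV by (auto simp: cycle_set_def hybrid_def)
  let ?F = "{W'. W' \<subseteq> V \<and> biconnected_on A W'}"
  have "finite ?F" using basic(1) by simp
  moreover have "?W \<in> ?F" using WV bic by blast
  ultimately obtain C where C: "C \<in> ?F" "?W \<subseteq> C" "\<forall>W'\<in>?F. C \<subseteq> W' \<longrightarrow> C = W'"
    using finite_has_maximal2[of ?F ?W] by blast
  then have "is_block V A C" unfolding is_block_def by blast
  moreover have "3 \<le> card C"
    using card_cycle_set[OF _ C(2) basic(3) par pq(1) w] C(1) finite_subset[OF _ basic(1)] by blast
  moreover have "h \<in> C" using C(2) by (auto simp: cycle_set_def)
  ultimately show ?thesis unfolding is_cycle_def by blast
qed

text \<open>\<open>common\<close> makes every common ancestor of two chosen leaves reach them by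
  arcs of \<open>B\<close> alone. So \<open>lca\<close>, although taken in the whole network, is
  computed in the tree \<open>B\<close>.\<close>

lemma p4free_subtree:
  assumes f: "f ` S \<subseteq> X" and B: "B \<subseteq> A"
    and uniq: "\<And>a b v. (a, v) \<in> B \<Longrightarrow> (b, v) \<in> B \<Longrightarrow> a = b"
    and reach: "\<And>x. x \<in> S \<Longrightarrow> (root, f x) \<in> B\<^sup>*"
    and common: "\<And>x y w. x \<in> S \<Longrightarrow> y \<in> S \<Longrightarrow> x \<noteq> y \<Longrightarrow> (w, f x) \<in> A\<^sup>* \<Longrightarrow> (w, f y) \<in> A\<^sup>* \<Longrightarrow> (w, f x) \<in> B\<^sup>*"
    and adj: "\<And>x y. x \<in> S \<Longrightarrow> y \<in> S \<Longrightarrow> x \<noteq> y \<Longrightarrow> E x y \<longleftrightarrow> t (lca V A (f x) (f y)) = L1"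
  shows "p4free S E"
proof (rule p4free_of_lca[where R = "B\<^sup>*" and f = f and P = "\<lambda>m. t m = L1"])
  have acyc: "acyclic B" using B basic(3) by (rule acyclic_subset[rotated])
  have BA: "(a, b) \<in> A\<^sup>*" if "(a, b) \<in> B\<^sup>*" for a b using that B by (meson rtrancl_mono subsetD)
  show "antisym (B\<^sup>*)" using acyc by (rule acyclic_impl_antisym_rtrancl)
  show "trans (B\<^sup>*)" by (rule trans_rtrancl)
  show "(u, v) \<in> B\<^sup>* \<or> (v, u) \<in> B\<^sup>*" if "(u, f x) \<in> B\<^sup>*" "(v, f x) \<in> B\<^sup>*" for x u v
    using comparable_ancestors[OF that] uniq by blast
  fix x y assume xy: "x \<in> S" "y \<in> S" "x \<noteq> y"
  obtain m where m: "(m, f x) \<in> B\<^sup>*" "(m, f y) \<in> B\<^sup>*"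
    "\<And>w. (w, f x) \<in> B\<^sup>* \<Longrightarrow> (w, f y) \<in> B\<^sup>* \<Longrightarrow> (w, m) \<in> B\<^sup>*"
    using ex_lowest_common_ancestor[OF finite_subset[OF B finite_arcs] acyc reach[OF xy(1)] reach[OF xy(2)]] uniq
    by metis
  have "m \<in> V" using m(1) B basic(2,4) f xy(1) by (blast elim: converse_rtranclE)
  then have "lca V A (f x) (f y) = m"
  proof (rule lca_eqI[OF basic(3)])
    fix w assume "(w, f x) \<in> A\<^sup>*" "(w, f y) \<in> A\<^sup>*"
    then have "(w, m) \<in> B\<^sup>*"
      using m(3) common[OF xy] common[OF xy(2,1) xy(3)[symmetric]] by blast
    then show "(w, m) \<in> A\<^sup>*" by (rule BA)
  qed (use m BA in auto)
  then show "\<exists>m. (m, f x) \<in> B\<^sup>* \<and> (m, f y) \<in> B\<^sup>* \<and>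
      (\<forall>w. (w, f x) \<in> B\<^sup>* \<and> (w, f y) \<in> B\<^sup>* \<longrightarrow> (w, m) \<in> B\<^sup>*) \<and> (E x y \<longleftrightarrow> t m = L1)"
    using m adj[OF xy] by blast
qed

end

locale one_cycle_network = rooted_network +
  fixes h p q x :: nat
  assumes hyb: "hybrid V A v \<longleftrightarrow> v = h"
    and par: "(a, h) \<in> A \<longleftrightarrow> a = p \<or> a = q" and pq: "p \<noteq> q"
    and child: "(h, c) \<in> A \<longleftrightarrow> c = x" and x: "x \<in> X"
    and apex: "(u, p) \<in> A\<^sup>* \<Longrightarrow> (u, q) \<in> A\<^sup>* \<Longrightarrow> u = root"
begin

lemma uniq: "(a, v) \<in> A \<Longrightarrow> (b, v) \<in> A \<Longrightarrow> v \<noteq> h \<Longrightarrow> a = b"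
  using unique_parent hyb by blast

sublocale N: one_hybrid V A root h p q
  by unfold_locales (use basic root_reaches uniq par pq in auto)

lemma x_neq_h: "x \<noteq> h"
  using child basic(3) by (auto simp: acyclic_def)

lemma parent_x: "(a, x) \<in> A \<longleftrightarrow> a = h"
  using child uniq x_neq_h by blast

lemma h_not_above: "y \<in> X \<Longrightarrow> y \<noteq> x \<Longrightarrow> (h, y) \<notin> A\<^sup>*"
  using leaf_path[OF x] child leaf_no_child by (metis converse_rtranclE)

lemma path_to_x: "(w, x) \<in> A\<^sup>* \<longleftrightarrow> w = x \<or> w = h \<or> (w, p) \<in> A\<^sup>* \<or> (w, q) \<in> A\<^sup>*"
proof -
  have "(w, x) \<in> A\<^sup>* \<longleftrightarrow> w = x \<or> (w, h) \<in> A\<^sup>*"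
    using parent_x by (metis rtrancl.simps)
  moreover have "(w, h) \<in> A\<^sup>* \<longleftrightarrow> w = h \<or> (w, p) \<in> A\<^sup>* \<or> (w, q) \<in> A\<^sup>*"
    using par by (metis rtrancl.simps)
  ultimately show ?thesis by blast
qed

lemma path_without_arc:
  assumes "(w, y) \<in> A\<^sup>*" "(h, y) \<notin> A\<^sup>*"
  shows "(w, y) \<in> (A - {(z, h)})\<^sup>*"
  using assms
proof (induction rule: rtrancl_induct)
  case (step y y')
  then have "y' \<noteq> h" "(h, y) \<notin> A\<^sup>*" by (auto intro: rtrancl.rtrancl_into_rtrancl)
  then show ?case using step by (meson DiffI Pair_inject rtrancl.rtrancl_into_rtrancl singletonD)
qed simp

lemma path_to_x_without_arc:
  assumes "{p, q} = {p', q'}" "w = x \<or> w = h \<or> (w, p') \<in> A\<^sup>*"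
  shows "(w, x) \<in> (A - {(q', h)})\<^sup>*"
proof -
  have "p' \<noteq> q'" "p' = p \<or> p' = q" using assms(1) pq by (auto simp: doubleton_eq_iff)
  then have arcs: "(h, x) \<in> A - {(q', h)}" "(p', h) \<in> A - {(q', h)}"
    using par[of p'] child x_neq_h by auto
  have "(w, p') \<in> (A - {(q', h)})\<^sup>*" if "(w, p') \<in> A\<^sup>*"
    using path_without_arc[OF that] N.not_above \<open>p' = p \<or> p' = q\<close> by blast
  then show ?thesis using assms(2) arcs by (meson r_into_rtrancl rtrancl.simps rtrancl_trans)
qed

text \<open>The leaves other than \<open>x\<close> hanging off the side of \<open>p\<close>. Leaves
  that hang off the root outside the cycle fall into the complement, together with those on the side
  of \<open>q\<close>.\<close>

definition branch :: "nat set" where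
  "branch = {y \<in> X. y \<noteq> x \<and> (\<exists>u. u \<noteq> root \<and> (u, p) \<in> A\<^sup>* \<and> (u, y) \<in> A\<^sup>*)}"

text \<open>The ancestors of \<open>y\<close> form a chain, as \<open>h\<close> is not among them.
  So \<open>w\<close> is comparable with the vertex \<open>u\<close> that puts \<open>y\<close> into
  the branch, and the upper one of the two is above both \<open>p\<close> and
  \<open>q\<close>.\<close>

lemma branch_meet:
  assumes y: "y \<in> branch" and w: "(w, y) \<in> A\<^sup>*" "(w, q) \<in> A\<^sup>*"
  shows "w = root"
proof -
  obtain u where u: "u \<noteq> root" "(u, p) \<in> A\<^sup>*" "(u, y) \<in> A\<^sup>*" and hy: "(h, y) \<notin> A\<^sup>*"
    using y h_not_above unfolding branch_def by blast
  have "(w, u) \<in> A\<^sup>* \<or> (u, w) \<in> A\<^sup>*" by (rule N.comparable[OF w(1) u(3) hy])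
  then show ?thesis
  proof
    assume "(w, u) \<in> A\<^sup>*"
    then show ?thesis using apex[OF _ w(2)] u(2) by (meson rtrancl_trans)
  next
    assume "(u, w) \<in> A\<^sup>*"
    then have "u = root" using apex[OF u(2)] w(2) by (meson rtrancl_trans)
    then show ?thesis using u(1) by simp
  qed
qed

lemma not_branch_meet:
  assumes "y \<in> X" "y \<noteq> x" "y \<notin> branch" "(w, y) \<in> A\<^sup>*" "(w, p) \<in> A\<^sup>*"
  shows "w = root"
  using assms unfolding branch_def by blast

lemma lca_cross:
  assumes y: "y \<in> branch" and z: "z \<in> X" "z \<noteq> x" "z \<notin> branch"
  shows "lca V A y z = root"
proof (rule lca_eqI[OF basic(3)])
  have yX: "y \<in> X" "y \<noteq> x" using y by (auto simp: branch_def)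
  show "root \<in> V" by (rule root_props)
  show "(root, y) \<in> A\<^sup>*" "(root, z) \<in> A\<^sup>*" using root_reaches basic(4) yX z by blast+
  fix w assume w: "(w, y) \<in> A\<^sup>*" "(w, z) \<in> A\<^sup>*"
  obtain u where u: "u \<noteq> root" "(u, p) \<in> A\<^sup>*" "(u, y) \<in> A\<^sup>*"
    using y unfolding branch_def by blast
  have "(w, u) \<in> A\<^sup>* \<or> (u, w) \<in> A\<^sup>*"
    by (rule N.comparable[OF w(1) u(3) h_not_above[OF yX]])
  then have "w = root"
  proof
    assume "(w, u) \<in> A\<^sup>*"
    then show ?thesis using not_branch_meet[OF z w(2)] u(2) by (meson rtrancl_trans)
  next
    assume "(u, w) \<in> A\<^sup>*"
    then have "u = root" using not_branch_meet[OF z _ u(2)] w(2) by (meson rtrancl_trans)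
    then show ?thesis using u(1) by simp
  qed
  then show "(w, root) \<in> A\<^sup>*" by simp
qed

text \<open>Being neither root, leaf nor hybrid-vertex, \<open>p\<close> has a child
  \<open>z\<close> besides \<open>h\<close>. A leaf below \<open>z\<close> cannot be
  \<open>x\<close>: every way to \<open>x\<close> passes through \<open>h\<close>, so
  \<open>z\<close> would lie above \<open>p\<close>, closing a directed cycle, or above
  \<open>q\<close>, making \<open>p\<close> a common ancestor of both parents.\<close>

lemma branch_nonempty:
  assumes "p \<noteq> root"
  shows "branch \<noteq> {}"
proof -
  have ph: "(p, h) \<in> A" using par by blast
  then have "p \<notin> X" "p \<noteq> h" using leaf_no_child basic(3) by (auto simp: acyclic_def)
  then have "indeg A p \<noteq> 2" using hyb[of p] N.in_V by (simp add: hybrid_def)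
  then have "2 \<le> card {c. (p, c) \<in> A}"
    using degrees(4)[OF N.in_V(1) assms \<open>p \<notin> X\<close>] by (simp add: outdeg_def)
  then have "\<not> {c. (p, c) \<in> A} \<subseteq> {h}"
    using card_mono[of "{h}" "{c. (p, c) \<in> A}"] by auto
  then obtain z where z: "(p, z) \<in> A" "z \<noteq> h" by blast
  then obtain y where y: "y \<in> X" "(z, y) \<in> A\<^sup>*" using leaf_below basic(2) by blast
  have py: "(p, y) \<in> A\<^sup>*" using z y by (meson converse_rtrancl_into_rtrancl)
  have "y \<noteq> x"
  proof
    assume "y = x"
    then consider "z = x" | "(z, p) \<in> A\<^sup>*" | "(z, q) \<in> A\<^sup>*" using path_to_x y(2) z(2) by blast
    then show False
    proof cases
      case 1
      then show False using z(1) parent_x \<open>p \<noteq> h\<close> by blast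
    next
      case 2
      then show False using z(1) basic(3) by (meson acyclic_def rtrancl_into_trancl2)
    next
      case 3
      then have "(p, q) \<in> A\<^sup>*" using z(1) by (meson converse_rtrancl_into_rtrancl)
      then show False using apex[of p] assms by blast
    qed
  qed
  then show ?thesis using y(1) py assms unfolding branch_def by blast
qed

lemma uniq_without_arc:
  assumes "{p, q} = {p', q'}" "(a, v) \<in> A - {(q', h)}" "(b, v) \<in> A - {(q', h)}"
  shows "a = b"
proof (cases "v = h")
  case True
  then show ?thesis using assms par[of a] par[of b] by auto
next
  case False
  then show ?thesis using assms uniq by blast
qed

text \<open>Deleting the arc from \<open>q'\<close> to \<open>h\<close> separates a vertex from a
  leaf only if the leaf is \<open>x\<close> and was reached through \<open>q'\<close> alone. By
  \<open>meet\<close>, among vertices above \<open>q'\<close> only the root lies above another leaf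
  of \<open>S\<close>, and the root still reaches \<open>x\<close> through
  \<open>p'\<close>.\<close>

lemma p4free_side:
  assumes pq': "{p, q} = {p', q'}" and f: "f ` S \<subseteq> X" "inj_on f S"
    and meet: "\<And>a w. a \<in> S \<Longrightarrow> f a \<noteq> x \<Longrightarrow> (w, f a) \<in> A\<^sup>* \<Longrightarrow> (w, q') \<in> A\<^sup>* \<Longrightarrow> w = root"
    and adj: "\<And>a b. a \<in> S \<Longrightarrow> b \<in> S \<Longrightarrow> a \<noteq> b \<Longrightarrow> E a b \<longleftrightarrow> t (lca V A (f a) (f b)) = L1"
  shows "p4free S E"
proof (rule p4free_subtree[OF f(1), of "A - {(q', h)}"])
  show "A - {(q', h)} \<subseteq> A" by blast
  show "a = b" if "(a, v) \<in> A - {(q', h)}" "(b, v) \<in> A - {(q', h)}" for a b v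
    using uniq_without_arc[OF pq' that] .
  have p': "p' = p \<or> p' = q" and sub: "\<And>w. (w, x) \<in> A\<^sup>* \<Longrightarrow> w = x \<or> w = h \<or> (w, p') \<in> A\<^sup>* \<or> (w, q') \<in> A\<^sup>*"
    using pq' path_to_x by (auto simp: doubleton_eq_iff)
  have root_p': "(root, p') \<in> A\<^sup>*" using p' root_reaches N.in_V by blast
  have leaf: "(w, f a) \<in> (A - {(q', h)})\<^sup>*" if "a \<in> S" "f a \<noteq> x" "(w, f a) \<in> A\<^sup>*" for a w
    using path_without_arc[OF that(3) h_not_above] that(1,2) f(1) by blast
  show "(root, f a) \<in> (A - {(q', h)})\<^sup>*" if a: "a \<in> S" for a
  proof (cases "f a = x")
    case True
    then show ?thesis using path_to_x_without_arc[OF pq'] root_p' by simp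
  next
    case False
    moreover have "(root, f a) \<in> A\<^sup>*" using root_reaches basic(4) f(1) a by blast
    ultimately show ?thesis using leaf a by blast
  qed
  show "(w, f a) \<in> (A - {(q', h)})\<^sup>*"
    if ab: "a \<in> S" "b \<in> S" "a \<noteq> b" "(w, f a) \<in> A\<^sup>*" "(w, f b) \<in> A\<^sup>*" for a b w
  proof (cases "f a = x")
    case True
    then have "f b \<noteq> x" using ab f(2) by (metis inj_onD)
    then have "(w, q') \<in> A\<^sup>* \<longrightarrow> w = root" using meet ab(2,5) by blast
    then have "w = x \<or> w = h \<or> (w, p') \<in> A\<^sup>*" using sub ab(4) True root_p' by metis
    then show ?thesis using path_to_x_without_arc[OF pq'] True by simp
  next
    case False
    then show ?thesis using leaf ab by blast
  qed
  show "E a b \<longleftrightarrow> t (lca V A (f a) (f b)) = L1" if "a \<in> S" "b \<in> S" "a \<noteq> b" for a b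
    by (rule adj[OF that])
qed

lemma pseudo_cograph_of_branch:
  assumes G: "is_graph G" and f: "bij_betw f (fst G) X" and p: "p \<noteq> root"
    and adj: "\<And>a b. a \<in> fst G \<Longrightarrow> b \<in> fst G \<Longrightarrow> a \<noteq> b \<Longrightarrow>
      (a, b) \<in> snd G \<longleftrightarrow> t (lca V A (f a) (f b)) = L1"
  shows "pseudo_cograph G"
proof -
  have fin: "finite (fst G)" using G by (simp add: is_graph_def)
  have inj: "inj_on f (fst G)" and fX: "\<And>a. a \<in> fst G \<Longrightarrow> f a \<in> X" and surj: "f ` fst G = X"
    using f by (auto simp: bij_betw_def)
  obtain v where v: "v \<in> fst G" "f v = x" using surj x by blast
  have fx: "f a = x \<longleftrightarrow> a = v" if "a \<in> fst G" for a using that v inj by (metis inj_onD)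
  define S where "S = {a \<in> fst G. f a \<in> branch}"
  have vS: "v \<notin> S" using v by (auto simp: S_def branch_def)
  have S: "S \<subseteq> fst G" by (auto simp: S_def)
  have "branch \<subseteq> X" by (auto simp: branch_def)
  then have "S \<noteq> {}" using branch_nonempty[OF p] surj by (fastforce simp: S_def)
  let ?V1 = "fst G - S" and ?V2 = "insert v S"
  let ?E = "\<lambda>a b. (a, b) \<in> snd G"
  have free1: "p4free ?V1 ?E"
  proof (rule p4free_side[of q p f])
    show "w = root" if "a \<in> ?V1" "f a \<noteq> x" "(w, f a) \<in> A\<^sup>*" "(w, p) \<in> A\<^sup>*" for a w
      using not_branch_meet[of "f a" w] that fX by (auto simp: S_def)
  qed (use fX inj adj in \<open>auto intro: inj_on_subset\<close>)
  have free2: "p4free ?V2 ?E"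
  proof (rule p4free_side[of p q f])
    show "w = root" if "a \<in> ?V2" "f a \<noteq> x" "(w, f a) \<in> A\<^sup>*" "(w, q) \<in> A\<^sup>*" for a w
      using branch_meet[of "f a" w] that v(2) by (auto simp: S_def)
    show "f ` ?V2 \<subseteq> X" using fX S v(1) by blast
    show "inj_on f ?V2" by (rule inj_on_subset[OF inj]) (use S v(1) in blast)
    show "?E a b \<longleftrightarrow> t (lca V A (f a) (f b)) = L1" if "a \<in> ?V2" "b \<in> ?V2" "a \<noteq> b" for a b
    proof -
      have "a \<in> fst G" "b \<in> fst G" using that S v(1) by blast+
      then show ?thesis by (rule adj[OF _ _ that(3)])
    qed
  qed simp
  show ?thesis
  proof (cases "?V1 = {v}")
    \<comment> \<open>This can occur when \<open>q\<close> is the root. The intended division is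
      then not admissible, but \<open>?V2\<close> is the whole graph.\<close>
    case True
    then have "?V2 = fst G" using S v by blast
    then show ?thesis using p4free_pseudo_cograph[OF G] free2 by simp
  next
    case False
    then have "\<not> ?V1 \<subseteq> {v}" using v vS by blast
    then obtain u where u: "u \<in> ?V1" "u \<noteq> v" by blast
    have "card {u, v} \<le> card ?V1" using u v vS fin by (intro card_mono) auto
    then have c1: "1 < card ?V1" using u(2) by simp
    have c2: "1 < card ?V2"
      using vS \<open>S \<noteq> {}\<close> finite_subset[OF S fin] by (simp add: card_gt_0_iff)
    have "\<forall>a\<in>?V1 - {v}. \<forall>b\<in>?V2 - {v}. (a, b) \<in> snd G \<longleftrightarrow> t root = L1"
    proof (intro ballI)
      fix a b assume a: "a \<in> ?V1 - {v}" and b: "b \<in> ?V2 - {v}"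
      then have "lca V A (f b) (f a) = root"
        using fx fX by (intro lca_cross) (auto simp: S_def)
      moreover have "a \<in> fst G" "b \<in> fst G" "a \<noteq> b" using a b S by auto
      ultimately show "(a, b) \<in> snd G \<longleftrightarrow> t root = L1"
        using adj[of a b] lca_commute[of V A "f a"] by simp
    qed
    moreover have "fst G = ?V1 \<union> ?V2" "?V1 \<inter> ?V2 = {v}" using S v vS by auto
    ultimately show ?thesis
      unfolding pseudo_cograph_iff[OF G] using free1 free2 c1 c2
      by (intro disjI2 exI[of _ ?V1] exI[of _ ?V2] exI[of _ v] exI[of _ "t root = L1"]) simp
  qed
qed

end

lemma network_pseudo_cograph:
  assumes G: "is_graph G" and net: "is_network V A X" and level: "level1 V A" and expl: "explains V A X t G"
    and C: "{C'. is_cycle V A C'} = {C}" "cycle_root A C = net_root V A"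
      "\<exists>!c. (cycle_hybrid V A C, c) \<in> A" "\<forall>c. (cycle_hybrid V A C, c) \<in> A \<longrightarrow> c \<in> X"
  shows "pseudo_cograph G"
proof (cases "card X = 1")
  case True
  then have "card (fst G) = 1" using expl by (auto simp: explains_def dest: bij_betw_same_card)
  then show ?thesis by (simp add: pseudo_cograph_def)
next
  case False
  interpret rooted_network V A X using net False by unfold_locales
  obtain f where f: "bij_betw f (fst G) X"
    and adj: "\<And>a b. a \<in> fst G \<Longrightarrow> b \<in> fst G \<Longrightarrow> a \<noteq> b \<Longrightarrow>
      (a, b) \<in> snd G \<longleftrightarrow> t (lca V A (f a) (f b)) = L1"
    using expl unfolding explains_def by blast
  have fX: "f a \<in> X" if "a \<in> fst G" for a using that f by (auto dest: bij_betwE)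
  have cycle_iff: "is_cycle V A C' \<longleftrightarrow> C' = C" for C'
    using C(1) by (metis mem_Collect_eq singleton_iff)
  then have CV: "C \<subseteq> V" "is_block V A C" by (metis is_block_def is_cycle_def)+
  have hC: "h \<in> C" if "hybrid V A h" for h using hybrid_in_cycle[OF that] cycle_iff by metis
  show ?thesis
  proof (cases "\<exists>h. hybrid V A h")
    \<comment> \<open>Here the network is a tree. Treating its graph directly avoids proving that a
      tree contains no cycle.\<close>
    case False
    have "p4free (fst G) (\<lambda>a b. (a, b) \<in> snd G)"
    proof (rule p4free_subtree[where B = A and f = f and t = t])
      show "a = b" if "(a, v) \<in> A" "(b, v) \<in> A" for a b v
        using unique_parent[OF that] False by blast
      show "(root, f a) \<in> A\<^sup>*" if "a \<in> fst G" for a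
        using root_reaches basic(4) fX[OF that] by blast
    qed (use fX adj in auto)
    then show ?thesis by (rule p4free_pseudo_cograph[OF G])
  next
    case True
    then obtain h where h: "hybrid V A h" by blast
    \<comment> \<open>All hybrid-vertices lie in the only cycle \<open>C\<close>, and level-1 admits
      at most one there.\<close>
    have hyb: "hybrid V A v \<longleftrightarrow> v = h" for v
    proof
      assume v: "hybrid V A v"
      have "finite {h \<in> C. hybrid V A h}" using finite_subset[OF CV(1) basic(1)] by simp
      then have "card {v, h} \<le> card {h \<in> C. hybrid V A h}"
        using hC v h by (intro card_mono) auto
      also have "\<dots> \<le> 1" using level CV(2) by (simp add: level1_def)
      finally show "v = h" by (cases "v = h") auto
    qed (use h in simp)
    obtain p q where pq: "p \<noteq> q" "\<And>a. (a, h) \<in> A \<longleftrightarrow> a = p \<or> a = q"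
      using hybrid_parents[OF h] by blast
    interpret one_hybrid V A root h p q
    proof
      show "a = b" if "(a, v) \<in> A" "(b, v) \<in> A" "v \<noteq> h" for a b v
        using unique_parent[OF that(1,2)] hyb that(3) by metis
      show "(a, h) \<in> A \<longleftrightarrow> a = p \<or> a = q" for a by (rule pq(2))
    qed (use basic root_reaches pq(1) in auto)
    obtain w where w: "(w, p) \<in> A\<^sup>*" "(w, q) \<in> A\<^sup>*"
      "\<And>u. (u, p) \<in> A\<^sup>* \<Longrightarrow> (u, q) \<in> A\<^sup>* \<Longrightarrow> (u, w) \<in> A\<^sup>*"
      using ex_apex by metis
    have CW: "C = cycle_set A w p q h" using cycles_eq[OF w] C(1) by (metis singleton_inject)
    have "w = root" using cycle_root_W[OF w] C(2) CW by simp
    \<comment> \<open>The condition on the cycle root enters in this form: nothing but the root lies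
      above both parents of \<open>h\<close>.\<close>
    have apex: "u = root" if "(u, p) \<in> A\<^sup>*" "(u, q) \<in> A\<^sup>*" for u
      using w(3)[OF that] \<open>w = root\<close> root_reaches[of u] rtrancl_antisym[OF basic(3)]
        ancestor_in_V[OF that(1)] in_V by blast
    have "cycle_hybrid V A C = h"
      unfolding cycle_hybrid_def hyb using hC[OF h] by blast
    then obtain x where x: "\<And>c. (h, c) \<in> A \<longleftrightarrow> c = x" "x \<in> X" using C(3,4) by metis
    show ?thesis
    \<comment> \<open>At most one parent of \<open>h\<close> is the root. The branch is taken at the
      other parent, which guarantees that it contains a leaf.\<close>
    proof (cases "p = root")
      case False
      interpret one_cycle_network V A X h p q x
        by (unfold_locales; fact hyb pq x apex)
      show ?thesis by (rule pseudo_cograph_of_branch[OF G f False adj])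
    next
      case True
      have par: "(a, h) \<in> A \<longleftrightarrow> a = q \<or> a = p" for a using pq(2) by metis
      have apex': "u = root" if "(u, q) \<in> A\<^sup>*" "(u, p) \<in> A\<^sup>*" for u
        by (rule apex[OF that(2,1)])
      interpret one_cycle_network V A X h q p x
        by (unfold_locales; fact hyb par pq(1)[symmetric] x apex')
      have "q \<noteq> root" using True pq(1) by simp
      then show ?thesis using pseudo_cograph_of_branch[OF G f _ adj] by blast
    qed
  qed
qed

theorem mainTheorem6:
  fixes G :: "'a graph"
  assumes "is_graph G"
  shows "pseudo_cograph G \<longleftrightarrow>
    card (fst G) \<le> 2 \<or>
    (\<exists>V A X t. is_network V A X \<and> level1 V A \<and> is_labeling V X t \<and> explains V A X t G \<and>
       (\<exists>C. {C'. is_cycle V A C'} = {C} \<and>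
            cycle_root A C = net_root V A \<and>
            (\<exists>!c. (cycle_hybrid V A C, c) \<in> A) \<and>
            (\<forall>c. (cycle_hybrid V A C, c) \<in> A \<longrightarrow> c \<in> X)))" (is "_ \<longleftrightarrow> _ \<or> ?N")
proof
  assume "pseudo_cograph G"
  then show "card (fst G) \<le> 2 \<or> ?N"
    unfolding pseudo_cograph_iff[OF assms]
    by (elim disjE exE conjE) (rule disjI1, assumption, rule disjI2, rule glued_network[OF assms])
next
  assume "card (fst G) \<le> 2 \<or> ?N"
  then show "pseudo_cograph G"
  proof
    assume "card (fst G) \<le> 2"
    then show ?thesis by (simp add: pseudo_cograph_def)
  next
    assume ?N
    then show ?thesis
      by (elim exE conjE) (rule network_pseudo_cograph[OF assms])
  qed
qed

end
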